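(* Let $(X,d)$ be a metric space and let $E$ be a dual Banach algebra with $E=F^*$. Let $\langle X\otimes F\rangle$ denote the linear span of $\{x\otimes z:\ x\in X,\ z\in F\}$ in $Lip_d(X,E)^*$, with the norm of $Lip_d(X,E)^*$. Then $Lip_d(X,E)\cong\langle X\otimes F\rangle^*$ as a dual Banach algebra; that is, the canonical map $f\mapsto\Phi_f$ determined by $\Phi_f(x\otimes z)=f(x)(z)$ is an isometric linear isomorphism of $Lip_d(X,E)$ onto $\langle X\otimes F\rangle^*$, and under this identification $Lip_d(X,E)$ is a dual Banach algebra with predual the norm closure of $\langle X\otimes F\rangle$.
   Context: A dual Banach algebra is a pair $(D,D_* )$ where $D$ is a Banach algebra, $D=(D_* )^*$ as a Banach space, and multiplication in $D$ is separately $\sigma(D,D_* )$-continuous; equivalently, $D\cdot D_*\subseteq D_*$ and $D_*\cdot D\subseteq D_*$, where $D_*\subseteq D^*$ canonically and $D^*$ carries its natural $D$-bimodule structure. Here $(E,F)$ is such a pair. For a metric space $(X,d)$ and a Banach algebra $E$, $Lip_d(X,E)$ is the space of all bounded maps $f:X\to E$ with $\rho_{d,E}(f)=\sup_{x\ne y}\frac{\|f(x)-f(y)\|_E}{d(x,y)}<\infty$, with norm $\|f\|=\max\{\rho_{d,E}(f),\|f\|_{\infty,E}\}$, where $\|f\|_{\infty,E}=\sup_{x\in X}\|f(x)\|_E$. With the pointwise product it is regarded as a Banach algebra (multiplication is jointly continuous for this norm). For $x\in X$, $z\in F$, $x\otimes z\in Lip_d(X,E)^*$ is the functional $(x\otimes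 z)(f)=f(x)(z)$, where $f(x)\in E=F^*$ is evaluated at $z$. *)

theory Defs
  imports "HOL-Analysis.Analysis" "HOL-Library.Function_Algebras"
begin

text \<open>
  The scalar field is a type \<open>'k::real_normed_field\<close>: by the Gelfand--Mazur theorem such a field is
  isometrically \<open>\<real>\<close> or \<open>\<complex>\<close>, so both the real and the complex theory are covered.

  Spaces are linear subspaces (field \<open>car\<close>) of an ambient type with its own addition; on function
  types this is the pointwise addition of \<^theory>\<open>HOL-Library.Function_Algebras\<close>. The scalar
  multiplication \<open>scl\<close> must be a vector space structure on the ambient type, whereas the values of
  the norm \<open>nrm\<close> outside \<open>car\<close> are irrelevant.
\<close>

record ('k, 'v) nspace =
  car :: "'v set"
  scl :: "'k \<Rightarrow> 'v \<Rightarrow> 'v"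
  nrm :: "'v \<Rightarrow> real"

record ('k, 'v) nalgebra = "('k, 'v) nspace" +
  mul :: "'v \<Rightarrow> 'v \<Rightarrow> 'v"

definition normed_space :: "('k::real_normed_field, 'v::ab_group_add, 'm) nspace_scheme \<Rightarrow> bool" where
  "normed_space V \<longleftrightarrow>
     vector_space (scl V) \<and> module.subspace (scl V) (car V) \<and>
     (\<forall>v\<in>car V. 0 \<le> nrm V v \<and> (nrm V v = 0 \<longleftrightarrow> v = 0)) \<and>
     (\<forall>c. \<forall>v\<in>car V. nrm V (scl V c v) = norm c * nrm V v) \<and>
     (\<forall>u\<in>car V. \<forall>v\<in>car V. nrm V (u + v) \<le> nrm V u + nrm V v)"

text \<open>The value off the carrier is fixed because the locale \<^locale>\<open>Metric_space\<close> wants a globally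
  nonnegative and symmetric distance function.\<close>

definition norm_dist :: "('k, 'v::ab_group_add, 'm) nspace_scheme \<Rightarrow> 'v \<Rightarrow> 'v \<Rightarrow> real" where
  "norm_dist V u v = (if u \<in> car V \<and> v \<in> car V then nrm V (u - v) else 0)"

definition norm_topology :: "('k, 'v::ab_group_add, 'm) nspace_scheme \<Rightarrow> 'v topology" where
  "norm_topology V = Metric_space.mtopology (car V) (norm_dist V)"

definition Banach_space :: "('k::real_normed_field, 'v::ab_group_add, 'm) nspace_scheme \<Rightarrow> bool" where
  "Banach_space V \<longleftrightarrow> normed_space V \<and> Metric_space.mcomplete (car V) (norm_dist V)"

text \<open>The norm of a Banach algebra is only required to make the multiplication jointly continuous
  (a bounded bilinear map), not to be submultiplicative: for the maximum norm of a Lipschitz algebra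
  one only gets \<open>\<parallel>f g\<parallel> \<le> 2 \<parallel>f\<parallel> \<parallel>g\<parallel>\<close> from submultiplicativity in the range. No unit is required.\<close>

definition Banach_algebra :: "('k::real_normed_field, 'v::ab_group_add, 'm) nalgebra_scheme \<Rightarrow> bool" where
  "Banach_algebra A \<longleftrightarrow>
     Banach_space A \<and>
     (\<forall>a\<in>car A. \<forall>b\<in>car A. mul A a b \<in> car A) \<and>
     (\<forall>a\<in>car A. \<forall>b\<in>car A. \<forall>c\<in>car A. mul A (mul A a b) c = mul A a (mul A b c)) \<and>
     (\<forall>a\<in>car A. \<forall>b\<in>car A. \<forall>c\<in>car A. mul A (a + b) c = mul A a c + mul A b c) \<and>
     (\<forall>a\<in>car A. \<forall>b\<in>car A. \<forall>c\<in>car A. mul A a (b + c) = mul A a b + mul A a c) \<and>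
     (\<forall>k. \<forall>a\<in>car A. \<forall>b\<in>car A.
        mul A (scl A k a) b = scl A k (mul A a b) \<and> mul A a (scl A k b) = scl A k (mul A a b)) \<and>
     (\<exists>C. \<forall>a\<in>car A. \<forall>b\<in>car A. nrm A (mul A a b) \<le> C * nrm A a * nrm A b)"

definition subspace_of ::
    "('k, 'v, 'm) nspace_scheme \<Rightarrow> 'v set \<Rightarrow> ('k, 'v) nspace" where
  "subspace_of V S = \<lparr>car = S, scl = scl V, nrm = nrm V\<rparr>"

text \<open>The normed dual. Functionals on \<open>car V\<close> are represented by functions on the ambient type that
  vanish outside \<open>car V\<close>, so that functionals agreeing on \<open>car V\<close> are equal.\<close>

definition dual_space ::
    "('k::real_normed_field, 'v::ab_group_add, 'm) nspace_scheme \<Rightarrow> ('k, 'v \<Rightarrow> 'k) nspace" where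
  "dual_space V =
     \<lparr>car = {\<phi>. (\<forall>u\<in>car V. \<forall>v\<in>car V. \<phi> (u + v) = \<phi> u + \<phi> v) \<and>
                 (\<forall>c. \<forall>v\<in>car V. \<phi> (scl V c v) = c * \<phi> v) \<and>
                 (\<exists>B. \<forall>v\<in>car V. norm (\<phi> v) \<le> B * nrm V v) \<and>
                 (\<forall>v. v \<notin> car V \<longrightarrow> \<phi> v = 0)},
      scl = (\<lambda>c \<phi> v. c * \<phi> v),
      nrm = (\<lambda>\<phi>. SUP v\<in>{v \<in> car V. nrm V v \<le> 1}. norm (\<phi> v))\<rparr>"

definition isometric_iso ::
    "('k, 'v::ab_group_add, 'm) nspace_scheme \<Rightarrow> ('k, 'w::ab_group_add, 'n) nspace_scheme \<Rightarrow>
     ('v \<Rightarrow> 'w) \<Rightarrow> bool" where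
  "isometric_iso V W T \<longleftrightarrow>
     bij_betw T (car V) (car W) \<and>
     (\<forall>u\<in>car V. \<forall>v\<in>car V. T (u + v) = T u + T v) \<and>
     (\<forall>c. \<forall>v\<in>car V. T (scl V c v) = scl W c (T v)) \<and>
     (\<forall>v\<in>car V. nrm W (T v) = nrm V v)"

text \<open>For an identification \<open>\<iota>\<close> of \<open>D\<close> with the dual of \<open>P\<close>, so that \<open>\<iota> d p\<close> is \<open>d\<close> evaluated at \<open>p\<close>,
  this is the topology \<open>\<sigma>(D, P)\<close> on \<open>car D\<close>.\<close>

definition weak_star_topology ::
    "('k::real_normed_field, 'v, 'm) nspace_scheme \<Rightarrow> ('k, 'p, 'n) nspace_scheme \<Rightarrow>
     ('v \<Rightarrow> 'p \<Rightarrow> 'k) \<Rightarrow> 'v topology" where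
  "weak_star_topology D P \<iota> =
     topology_generated_by {{d \<in> car D. \<iota> d p \<in> U} | p U. p \<in> car P \<and> open U}"

definition dual_Banach_algebra ::
    "('k::real_normed_field, 'v::ab_group_add, 'm) nalgebra_scheme \<Rightarrow>
     ('k, 'p::ab_group_add, 'n) nspace_scheme \<Rightarrow> ('v \<Rightarrow> 'p \<Rightarrow> 'k) \<Rightarrow> bool" where
  "dual_Banach_algebra D P \<iota> \<longleftrightarrow>
     Banach_algebra D \<and> Banach_space P \<and> isometric_iso D (dual_space P) \<iota> \<and>
     (\<forall>a\<in>car D.
        continuous_map (weak_star_topology D P \<iota>) (weak_star_topology D P \<iota>) (\<lambda>d. mul D a d) \<and>
        continuous_map (weak_star_topology D P \<iota>) (weak_star_topology D P \<iota>) (\<lambda>d. mul D d a))"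

definition lip_quotients ::
    "('k, 'e::ab_group_add, 'm) nspace_scheme \<Rightarrow> ('x::metric_space \<Rightarrow> 'e) \<Rightarrow> real set" where
  "lip_quotients E f = {nrm E (f x - f y) / dist x y | x y. x \<noteq> y}"

text \<open>The inserted \<open>0\<close> only matters for a one-point space, where the supremum over pairs of distinct
  points is a supremum over the empty set in \<open>[0, \<infinity>)\<close>.\<close>

definition lip_const ::
    "('k, 'e::ab_group_add, 'm) nspace_scheme \<Rightarrow> ('x::metric_space \<Rightarrow> 'e) \<Rightarrow> real" where
  "lip_const E f = Sup (insert 0 (lip_quotients E f))"

definition Lip ::
    "('k, 'e::ab_group_add, 'm) nalgebra_scheme \<Rightarrow> ('k, 'x::metric_space \<Rightarrow> 'e) nalgebra" where
  "Lip E =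
     \<lparr>car = {f. range f \<subseteq> car E \<and> bdd_above (range (\<lambda>x. nrm E (f x))) \<and>
                bdd_above (lip_quotients E f)},
      scl = (\<lambda>c f x. scl E c (f x)),
      nrm = (\<lambda>f. max (lip_const E f) (SUP x. nrm E (f x))),
      mul = (\<lambda>f g x. mul E (f x) (g x))\<rparr>"

text \<open>The functional \<open>x \<otimes> z\<close> on \<open>Lip E\<close>, where \<open>\<iota>\<close> identifies \<open>E\<close> with the dual of the space
  containing \<open>z\<close>.\<close>

definition point_tensor ::
    "('k::real_normed_field, 'e::ab_group_add, 'm) nalgebra_scheme \<Rightarrow> ('e \<Rightarrow> 'f \<Rightarrow> 'k) \<Rightarrow>
     'x::metric_space \<Rightarrow> 'f \<Rightarrow> (('x \<Rightarrow> 'e) \<Rightarrow> 'k)" where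
  "point_tensor E \<iota> x z = (\<lambda>f. if f \<in> car (Lip E) then \<iota> (f x) z else 0)"

definition tensor_span ::
    "('k::real_normed_field, 'e::ab_group_add, 'm) nalgebra_scheme \<Rightarrow> ('k, 'f, 'n) nspace_scheme \<Rightarrow>
     ('e \<Rightarrow> 'f \<Rightarrow> 'k) \<Rightarrow> ('k, ('x::metric_space \<Rightarrow> 'e) \<Rightarrow> 'k) nspace" where
  "tensor_span E F \<iota> =
     subspace_of (dual_space (Lip E))
       (module.span (scl (dual_space (Lip E :: ('k, 'x \<Rightarrow> 'e) nalgebra)))
          {point_tensor E \<iota> x z | x z. z \<in> car F})"

definition tensor_predual ::
    "('k::real_normed_field, 'e::ab_group_add, 'm) nalgebra_scheme \<Rightarrow> ('k, 'f, 'n) nspace_scheme \<Rightarrow>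
     ('e \<Rightarrow> 'f \<Rightarrow> 'k) \<Rightarrow> ('k, ('x::metric_space \<Rightarrow> 'e) \<Rightarrow> 'k) nspace" where
  "tensor_predual E F \<iota> =
     subspace_of (dual_space (Lip E))
       (norm_topology (dual_space (Lip E)) closure_of car (tensor_span E F \<iota>))"

text \<open>For a space \<open>P\<close> of functionals, the element \<open>v\<close> viewed as the functional \<open>u \<mapsto> u v\<close> on \<open>P\<close>.\<close>

definition evaluation ::
    "('k, 'v \<Rightarrow> 'k::zero, 'm) nspace_scheme \<Rightarrow> 'v \<Rightarrow> (('v \<Rightarrow> 'k) \<Rightarrow> 'k)" where
  "evaluation P v = (\<lambda>u. if u \<in> car P then u v else 0)"

end

theory Submission
  imports Defs
begin

text \<open>
  The functionals \<open>x \<otimes> z\<close> and \<open>(x \<otimes> z - y \<otimes> z) / d(x, y)\<close> have norm at most \<open>\<parallel>z\<parallel>\<close>, and the norm of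
  an element of \<open>E = F\<^sup>*\<close> is its supremum over the unit ball of \<open>F\<close>; hence both parts of the Lipschitz
  norm of \<open>f\<close> are recovered from the values of \<open>f\<close> on the span of the \<open>x \<otimes> z\<close>, and evaluation is
  isometric. Conversely, a bounded functional \<open>\<phi>\<close> on the span is evaluation at the map \<open>f\<close> with
  \<open>f(x) = \<phi>(x \<otimes> -) \<in> F\<^sup>* = E\<close>, and by density the same holds for the closure of the span.

  Weak-star continuity of the multiplication by \<open>a\<close> amounts to the invariance of the predual under
  the adjoint of that multiplication. This adjoint maps \<open>x \<otimes> z\<close> to \<open>x \<otimes> w\<close>, where \<open>w \<in> F\<close>
  represents \<open>e \<mapsto> (a(x) e)(z)\<close>, so it preserves the span and, being bounded, its closure.
\<close>

section \<open>Normed spaces and their duals\<close>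

lemma dual_space_sel [simp]:
  "scl (dual_space V) c \<phi> = (\<lambda>v. c * \<phi> v)"
  "car (subspace_of V S) = S" "scl (subspace_of V S) = scl V" "nrm (subspace_of V S) = nrm V"
  by (simp_all add: dual_space_def subspace_of_def)

lemma mem_dual_space:
  "\<phi> \<in> car (dual_space V) \<longleftrightarrow>
     (\<forall>u\<in>car V. \<forall>v\<in>car V. \<phi> (u + v) = \<phi> u + \<phi> v) \<and>
     (\<forall>c. \<forall>v\<in>car V. \<phi> (scl V c v) = c * \<phi> v) \<and>
     (\<exists>B. \<forall>v\<in>car V. norm (\<phi> v) \<le> B * nrm V v) \<and> (\<forall>v. v \<notin> car V \<longrightarrow> \<phi> v = 0)"
  by (simp add: dual_space_def)

lemma nrm_dual_space:
  "nrm (dual_space V) \<phi> = (SUP v\<in>{v \<in> car V. nrm V v \<le> 1}. norm (\<phi> v))"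
  by (simp add: dual_space_def)

lemma vector_space_dual_scl: "vector_space (scl (dual_space V))"
  by unfold_locales (auto simp: fun_eq_iff algebra_simps)

lemma dual_space_eqI:
  assumes "\<phi> \<in> car (dual_space V)" "\<psi> \<in> car (dual_space V)" "\<And>v. v \<in> car V \<Longrightarrow> \<phi> v = \<psi> v"
  shows "\<phi> = \<psi>"
proof
  fix v show "\<phi> v = \<psi> v"
    using assms by (cases "v \<in> car V") (simp_all add: mem_dual_space)
qed

section \<open>Normed spaces on a carrier: Cauchy sequences, closures, transport of
  completeness\<close>

locale normed_vs =
  fixes V :: "('k::real_normed_field, 'v::ab_group_add, 'm) nspace_scheme"
  assumes normed: "normed_space V"
begin

sublocale vector_space "scl V"
  using normed by (simp add: normed_space_def)

lemma subspace_car: "subspace (car V)"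
  using normed by (simp add: normed_space_def)

lemma zero_mem [simp]: "0 \<in> car V"
  using subspace_car by (rule subspace_0)

lemma add_mem [simp]: "u \<in> car V \<Longrightarrow> v \<in> car V \<Longrightarrow> u + v \<in> car V"
  using subspace_car by (rule subspace_add)

lemma diff_mem [simp]: "u \<in> car V \<Longrightarrow> v \<in> car V \<Longrightarrow> u - v \<in> car V"
  using subspace_car by (rule subspace_diff)

lemma scl_mem [simp]: "v \<in> car V \<Longrightarrow> scl V c v \<in> car V"
  using subspace_car by (rule subspace_scale)

lemma nrm_nonneg [simp]: "v \<in> car V \<Longrightarrow> 0 \<le> nrm V v"
  using normed by (simp add: normed_space_def)

lemma nrm_eq_0_iff [simp]: "v \<in> car V \<Longrightarrow> nrm V v = 0 \<longleftrightarrow> v = 0"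
  using normed by (simp add: normed_space_def)

lemma nrm_zero [simp]: "nrm V 0 = 0"
  by simp

lemma nrm_scl: "v \<in> car V \<Longrightarrow> nrm V (scl V c v) = norm c * nrm V v"
  using normed by (simp add: normed_space_def)

lemma nrm_triangle: "u \<in> car V \<Longrightarrow> v \<in> car V \<Longrightarrow> nrm V (u + v) \<le> nrm V u + nrm V v"
  using normed by (simp add: normed_space_def)

lemma nrm_diff_commute: "u \<in> car V \<Longrightarrow> v \<in> car V \<Longrightarrow> nrm V (u - v) = nrm V (v - u)"
  using nrm_scl[of "u - v" "-1"] by simp

lemma nrm_diff_triangle:
  assumes "u \<in> car V" "v \<in> car V" "w \<in> car V"
  shows "nrm V (u - w) \<le> nrm V (u - v) + nrm V (v - w)"
  using nrm_triangle[of "u - v" "v - w"] assms by simp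

lemma Metric_space_norm_dist: "Metric_space (car V) (norm_dist V)"
  by unfold_locales
    (auto simp: norm_dist_def nrm_diff_commute intro: nrm_diff_triangle)

text \<open>Differences of carrier elements stay in the carrier, where \<open>norm_dist\<close> is
  the norm of the difference. Completeness can thus be handled later by estimates on
  \<open>nrm\<close> alone.\<close>

lemma Banach_space_iff:
  "Banach_space V \<longleftrightarrow>
     (\<forall>\<sigma>::nat \<Rightarrow> 'v. range \<sigma> \<subseteq> car V \<and> (\<forall>\<epsilon>>0. \<exists>N. \<forall>m\<ge>N. \<forall>n\<ge>N. nrm V (\<sigma> m - \<sigma> n) < \<epsilon>) \<longrightarrow>
        (\<exists>l\<in>car V. \<forall>\<epsilon>>0. \<exists>N. \<forall>n\<ge>N. nrm V (\<sigma> n - l) < \<epsilon>))"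
proof -
  interpret M: Metric_space "car V" "norm_dist V"
    by (rule Metric_space_norm_dist)
  have c: "M.MCauchy \<sigma> \<longleftrightarrow>
      range \<sigma> \<subseteq> car V \<and> (\<forall>\<epsilon>>0. \<exists>N. \<forall>m\<ge>N. \<forall>n\<ge>N. nrm V (\<sigma> m - \<sigma> n) < \<epsilon>)" for \<sigma>
  proof (cases "range \<sigma> \<subseteq> car V")
    case True
    then have "norm_dist V (\<sigma> m) (\<sigma> n) = nrm V (\<sigma> m - \<sigma> n)" for m n
      by (auto simp: norm_dist_def)
    with True show ?thesis by (simp add: M.MCauchy_def)
  qed (simp add: M.MCauchy_def)
  have l: "(\<exists>l. limitin M.mtopology \<sigma> l sequentially) \<longleftrightarrow>
      (\<exists>l\<in>car V. \<forall>\<epsilon>>0. \<exists>N. \<forall>n\<ge>N. nrm V (\<sigma> n - l) < \<epsilon>)"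
    if \<sigma>: "range \<sigma> \<subseteq> car V" for \<sigma>
  proof -
    have "\<sigma> n \<in> car V" for n using \<sigma> by blast
    moreover from this have "norm_dist V (\<sigma> n) l = nrm V (\<sigma> n - l)" if "l \<in> car V" for n l
      using that by (simp add: norm_dist_def)
    ultimately have "limitin M.mtopology \<sigma> l sequentially \<longleftrightarrow>
        l \<in> car V \<and> (\<forall>\<epsilon>>0. \<exists>N. \<forall>n\<ge>N. nrm V (\<sigma> n - l) < \<epsilon>)" for l
      unfolding M.limit_metric_sequentially by (cases "l \<in> car V") simp_all
    then show ?thesis by blast
  qed
  have "M.mcomplete \<longleftrightarrow>
      (\<forall>\<sigma>::nat \<Rightarrow> 'v. range \<sigma> \<subseteq> car V \<and> (\<forall>\<epsilon>>0. \<exists>N. \<forall>m\<ge>N. \<forall>n\<ge>N. nrm V (\<sigma> m - \<sigma> n) < \<epsilon>) \<longrightarrow>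
        (\<exists>l\<in>car V. \<forall>\<epsilon>>0. \<exists>N. \<forall>n\<ge>N. nrm V (\<sigma> n - l) < \<epsilon>))"
    unfolding M.mcomplete_def c by (simp add: l cong: conj_cong)
  then show ?thesis
    using normed by (simp add: Banach_space_def)
qed

lemma Banach_space_limit:
  fixes \<sigma> :: "nat \<Rightarrow> 'v"
  assumes "Banach_space V" "range \<sigma> \<subseteq> car V"
    and "\<forall>\<epsilon>>0. \<exists>N. \<forall>m\<ge>N. \<forall>n\<ge>N. nrm V (\<sigma> m - \<sigma> n) < \<epsilon>"
  obtains l where "l \<in> car V" "\<forall>\<epsilon>>0. \<exists>N. \<forall>n\<ge>N. nrm V (\<sigma> n - l) < \<epsilon>"
proof -
  have "\<exists>l\<in>car V. \<forall>\<epsilon>>0. \<exists>N. \<forall>n\<ge>N. nrm V (\<sigma> n - l) < \<epsilon>"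
    using assms(1) unfolding Banach_space_iff by (elim allE[of _ \<sigma>] mp) (intro conjI assms)
  then show thesis using that by auto
qed

lemma mem_norm_closure:
  assumes "S \<subseteq> car V"
  shows "u \<in> norm_topology V closure_of S \<longleftrightarrow>
     u \<in> car V \<and> (\<forall>\<epsilon>>0. \<exists>v\<in>S. nrm V (u - v) < \<epsilon>)"
proof -
  interpret M: Metric_space "car V" "norm_dist V"
    by (rule Metric_space_norm_dist)
  have "(\<exists>v\<in>S. v \<in> M.mball u \<epsilon>) \<longleftrightarrow> (\<exists>v\<in>S. nrm V (u - v) < \<epsilon>)" if "u \<in> car V" for \<epsilon>
    using that assms by (intro bex_cong refl) (auto simp: norm_dist_def)
  then show ?thesis
    unfolding norm_topology_def M.metric_closure_of by auto
qed

lemma normed_subspace_of: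
  assumes "subspace S" "S \<subseteq> car V"
  shows "normed_space (subspace_of V S)"
  using normed assms unfolding normed_space_def by (auto simp: subset_iff)

lemma subspace_norm_closure:
  assumes S: "subspace S" "S \<subseteq> car V"
  shows "subspace (norm_topology V closure_of S)"
proof (rule subspaceI)
  note mem = mem_norm_closure[OF S(2)]
  show "0 \<in> norm_topology V closure_of S"
    unfolding mem using subspace_0[OF S(1)] by force
  fix u v c assume u: "u \<in> norm_topology V closure_of S"
  show "scl V c u \<in> norm_topology V closure_of S"
    unfolding mem
  proof (intro conjI allI impI)
    show "scl V c u \<in> car V" using u mem by simp
    fix \<epsilon> :: real assume "\<epsilon> > 0"
    \<comment> \<open>Dividing by \<open>norm c + 1\<close> instead of \<open>norm c\<close> keeps
      the tolerance positive for \<open>c = 0\<close> as well.\<close>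
    then obtain s where s: "s \<in> S" "nrm V (u - s) < \<epsilon> / (norm c + 1)"
      using u unfolding mem by (metis add_nonneg_pos divide_pos_pos norm_ge_zero zero_less_one)
    have "nrm V (scl V c u - scl V c s) = norm c * nrm V (u - s)"
      using nrm_scl[of "u - s" c] s u S(2) mem by (auto simp: scale_right_diff_distrib subset_iff)
    also have "\<dots> \<le> norm c * (\<epsilon> / (norm c + 1))"
      using s by (intro mult_left_mono) auto
    also have "\<dots> < \<epsilon>"
      using \<open>\<epsilon> > 0\<close> by (simp add: divide_less_eq algebra_simps not_less)
    finally show "\<exists>v\<in>S. nrm V (scl V c u - v) < \<epsilon>"
      using s subspace_scale[OF S(1)] by blast
  qed
  assume v: "v \<in> norm_topology V closure_of S"
  show "u + v \<in> norm_topology V closure_of S"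
    unfolding mem
  proof (intro conjI allI impI)
    show "u + v \<in> car V" using u v mem by simp
    fix \<epsilon> :: real assume "\<epsilon> > 0"
    then have "\<epsilon> / 2 > 0" by simp
    then obtain s t where s: "s \<in> S" "nrm V (u - s) < \<epsilon> / 2" and t: "t \<in> S" "nrm V (v - t) < \<epsilon> / 2"
      using u v unfolding mem by meson
    have "nrm V ((u - s) + (v - t)) \<le> nrm V (u - s) + nrm V (v - t)"
      using s t u v S(2) mem by (intro nrm_triangle) auto
    then have "nrm V ((u + v) - (s + t)) < \<epsilon>"
      using s t by (simp add: algebra_simps)
    then show "\<exists>w\<in>S. nrm V (u + v - w) < \<epsilon>"
      using s t subspace_add[OF S(1)] by blast
  qed
qed

text \<open>A Cauchy sequence in the closure converges in \<open>V\<close>; some term is within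
  \<epsilon>/2 of the limit, and that term is within \<epsilon>/2 of \<open>S\<close>, so the limit
  lies in the closure.\<close>

lemma Banach_space_norm_closure:
  assumes "Banach_space V" and S: "subspace S" "S \<subseteq> car V"
  shows "Banach_space (subspace_of V (norm_topology V closure_of S))"
proof -
  let ?C = "norm_topology V closure_of S"
  note mem = mem_norm_closure[OF S(2)]
  have sub: "?C \<subseteq> car V" using mem by blast
  interpret C: normed_vs "subspace_of V ?C"
    by unfold_locales (intro normed_subspace_of subspace_norm_closure S sub)
  show ?thesis
    unfolding C.Banach_space_iff dual_space_sel
  proof (intro allI impI; elim conjE)
    fix \<sigma> :: "nat \<Rightarrow> 'v" assume \<sigma>: "range \<sigma> \<subseteq> ?C" "\<forall>\<epsilon>>0. \<exists>N. \<forall>m\<ge>N. \<forall>n\<ge>N. nrm V (\<sigma> m - \<sigma> n) < \<epsilon>"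
    with sub have "range \<sigma> \<subseteq> car V" by blast
    with \<sigma>(2) obtain l where l: "l \<in> car V" "\<forall>\<epsilon>>0. \<exists>N. \<forall>n\<ge>N. nrm V (\<sigma> n - l) < \<epsilon>"
      using Banach_space_limit[OF \<open>Banach_space V\<close>] by metis
    have "\<exists>v\<in>S. nrm V (l - v) < \<epsilon>" if "\<epsilon> > 0" for \<epsilon>
    proof -
      have "\<epsilon> / 2 > 0" using that by simp
      then obtain n where n: "nrm V (\<sigma> n - l) < \<epsilon> / 2" using l(2) by (metis order_refl)
      have "\<sigma> n \<in> ?C" using \<sigma> by blast
      then obtain v where v: "v \<in> S" "nrm V (\<sigma> n - v) < \<epsilon> / 2"
        using \<open>\<epsilon> / 2 > 0\<close> unfolding mem by blast
      have "nrm V (l - v) \<le> nrm V (l - \<sigma> n) + nrm V (\<sigma> n - v)"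
        using l v S(2) \<open>\<sigma> n \<in> ?C\<close> sub by (intro nrm_diff_triangle) auto
      also have "nrm V (l - \<sigma> n) = nrm V (\<sigma> n - l)"
        using l \<open>\<sigma> n \<in> ?C\<close> sub by (intro nrm_diff_commute) auto
      finally show ?thesis using n v by force
    qed
    with l have "l \<in> ?C" unfolding mem by blast
    with l show "\<exists>l\<in>?C. \<forall>\<epsilon>>0. \<exists>N. \<forall>n\<ge>N. nrm V (\<sigma> n - l) < \<epsilon>" by blast
  qed
qed

text \<open>An isometry maps Cauchy sequences to Cauchy sequences, and surjectivity pulls the limit
  back. This is how \<open>Lip E\<close> inherits completeness from a dual space.\<close>

lemma Banach_space_isometric_iso:
  assumes "isometric_iso V W T" "Banach_space W"
  shows "Banach_space V"
  unfolding Banach_space_iff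
proof (intro allI impI; elim conjE)
  interpret W: normed_vs W
    using assms by unfold_locales (simp add: Banach_space_def)
  have T: "bij_betw T (car V) (car W)" "\<And>u v. u \<in> car V \<Longrightarrow> v \<in> car V \<Longrightarrow> T (u + v) = T u + T v"
    "\<And>v. v \<in> car V \<Longrightarrow> nrm W (T v) = nrm V v"
    using assms by (auto simp: isometric_iso_def)
  have Td: "T (u - v) = T u - T v" if "u \<in> car V" "v \<in> car V" for u v
    using T(2)[of "u - v" v] that by (simp add: algebra_simps)
  have Tc: "T v \<in> car W" if "v \<in> car V" for v
    using T(1) that by (auto simp: bij_betw_def)
  fix \<sigma> :: "nat \<Rightarrow> 'v" assume \<sigma>: "range \<sigma> \<subseteq> car V" "\<forall>\<epsilon>>0. \<exists>N. \<forall>m\<ge>N. \<forall>n\<ge>N. nrm V (\<sigma> m - \<sigma> n) < \<epsilon>"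
  then have s: "\<sigma> n \<in> car V" for n by auto
  have eq: "nrm W (T u - T v) = nrm V (u - v)" if "u \<in> car V" "v \<in> car V" for u v
    using that T(3)[of "u - v"] by (simp add: Td)
  have "\<forall>\<epsilon>>0. \<exists>N. \<forall>m\<ge>N. \<forall>n\<ge>N. nrm W (T (\<sigma> m) - T (\<sigma> n)) < \<epsilon>"
    using \<sigma>(2) s by (simp add: eq)
  moreover have "range (\<lambda>n. T (\<sigma> n)) \<subseteq> car W" using s Tc by blast
  ultimately obtain l where l: "l \<in> car W" "\<forall>\<epsilon>>0. \<exists>N. \<forall>n\<ge>N. nrm W (T (\<sigma> n) - l) < \<epsilon>"
    using W.Banach_space_limit[OF assms(2)] by metis
  then obtain u where "u \<in> car V" "l = T u" using T(1) unfolding bij_betw_def by blast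
  then show "\<exists>l\<in>car V. \<forall>\<epsilon>>0. \<exists>N. \<forall>n\<ge>N. nrm V (\<sigma> n - l) < \<epsilon>"
    using l s by (auto simp: eq intro!: bexI[of _ u])
qed

section \<open>The dual norm and completeness of the dual\<close>

lemma dual_zero: "\<phi> \<in> car (dual_space V) \<Longrightarrow> \<phi> 0 = 0"
  by (simp add: mem_dual_space) (metis add_cancel_right_right zero_mem)

lemma dual_bdd_above:
  assumes "\<phi> \<in> car (dual_space V)"
  shows "bdd_above ((\<lambda>v. norm (\<phi> v)) ` {v \<in> car V. nrm V v \<le> 1})"
proof -
  obtain B where B: "\<And>v. v \<in> car V \<Longrightarrow> norm (\<phi> v) \<le> B * nrm V v"
    using assms unfolding mem_dual_space by blast
  \<comment> \<open>The bound \<open>B\<close> may be negative when \<open>V\<close> is trivial,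
    hence the absolute value.\<close>
  have "norm (\<phi> v) \<le> \<bar>B\<bar>" if "v \<in> car V" "nrm V v \<le> 1" for v
  proof -
    have "B * nrm V v \<le> \<bar>B\<bar> * 1" using that by (intro mult_mono) auto
    then show ?thesis using B[of v] that by simp
  qed
  then show ?thesis by (auto simp: bdd_above_def)
qed

text \<open>The dual norm is a supremum over the unit ball, so a nonzero \<open>v\<close> is
  rescaled to norm 1; the vector 0 is treated apart.\<close>

lemma dual_bound:
  assumes \<phi>: "\<phi> \<in> car (dual_space V)" and v: "v \<in> car V"
  shows "norm (\<phi> v) \<le> nrm (dual_space V) \<phi> * nrm V v"
proof (cases "v = 0")
  case True
  then show ?thesis using dual_zero[OF \<phi>] by simp
next
  case False
  then have pos: "nrm V v > 0" using v by (metis nrm_eq_0_iff nrm_nonneg order_le_less)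
  let ?c = "of_real (1 / nrm V v) :: 'k"
  have "norm (\<phi> (scl V ?c v)) \<le> nrm (dual_space V) \<phi>"
    unfolding nrm_dual_space using pos v
    by (intro cSUP_upper[OF _ dual_bdd_above[OF \<phi>]]) (simp add: nrm_scl norm_divide)
  moreover have "norm (\<phi> (scl V ?c v)) = norm (\<phi> v) / nrm V v"
    using \<phi> v pos by (simp add: mem_dual_space norm_mult norm_divide)
  ultimately show ?thesis using pos by (simp add: pos_divide_le_eq)
qed

lemma dual_nrm_le:
  assumes "0 \<le> B" "\<And>v. v \<in> car V \<Longrightarrow> norm (\<phi> v) \<le> B * nrm V v"
  shows "nrm (dual_space V) \<phi> \<le> B"
  unfolding nrm_dual_space
proof (rule cSUP_least)
  show "{v \<in> car V. nrm V v \<le> 1} \<noteq> {}" by (auto intro!: exI[of _ 0])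
  fix v assume v: "v \<in> {v \<in> car V. nrm V v \<le> 1}"
  then have "B * nrm V v \<le> B * 1" using assms by (intro mult_left_mono) auto
  then show "norm (\<phi> v) \<le> B" using assms(2)[of v] v by simp
qed

lemma dual_nrm_nonneg:
  assumes "\<phi> \<in> car (dual_space V)"
  shows "0 \<le> nrm (dual_space V) \<phi>"
  unfolding nrm_dual_space
  by (rule cSUP_upper2[OF dual_bdd_above[OF assms], of 0]) auto

lemma normed_dual_space: "normed_space (dual_space V)"
proof -
  interpret D: vector_space "scl (dual_space V)" by (rule vector_space_dual_scl)
  have add: "\<phi> + \<psi> \<in> car (dual_space V) \<and>
      nrm (dual_space V) (\<phi> + \<psi>) \<le> nrm (dual_space V) \<phi> + nrm (dual_space V) \<psi>"
    if "\<phi> \<in> car (dual_space V)" "\<psi> \<in> car (dual_space V)" for \<phi> \<psi>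
  proof -
    have b: "norm ((\<phi> + \<psi>) v) \<le> (nrm (dual_space V) \<phi> + nrm (dual_space V) \<psi>) * nrm V v"
      if v: "v \<in> car V" for v
      using dual_bound[OF \<open>\<phi> \<in> _\<close> v] dual_bound[OF \<open>\<psi> \<in> _\<close> v] norm_triangle_ineq[of "\<phi> v" "\<psi> v"]
      by (simp add: algebra_simps)
    then have "\<exists>B. \<forall>v\<in>car V. norm ((\<phi> + \<psi>) v) \<le> B * nrm V v" by blast
    then have "\<phi> + \<psi> \<in> car (dual_space V)"
      using that by (simp add: mem_dual_space algebra_simps)
    then show ?thesis
      using b that by (intro conjI dual_nrm_le add_nonneg_nonneg dual_nrm_nonneg)
  qed
  have scl: "scl (dual_space V) c \<phi> \<in> car (dual_space V) \<and>
      nrm (dual_space V) (scl (dual_space V) c \<phi>) \<le> norm c * nrm (dual_space V) \<phi>"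
    if "\<phi> \<in> car (dual_space V)" for c \<phi>
  proof -
    have b: "norm (scl (dual_space V) c \<phi> v) \<le> (norm c * nrm (dual_space V) \<phi>) * nrm V v"
      if v: "v \<in> car V" for v
      using mult_left_mono[OF dual_bound[OF \<open>\<phi> \<in> _\<close> v], of "norm c"]
      by (simp add: norm_mult mult.assoc)
    then have "\<exists>B. \<forall>v\<in>car V. norm (scl (dual_space V) c \<phi> v) \<le> B * nrm V v" by blast
    then have "scl (dual_space V) c \<phi> \<in> car (dual_space V)"
      using that by (simp add: mem_dual_space algebra_simps)
    then show ?thesis
      using b that by (intro conjI dual_nrm_le mult_nonneg_nonneg dual_nrm_nonneg) auto
  qed
  have zero: "0 \<in> car (dual_space V)" by (auto simp: mem_dual_space intro!: exI[of _ 0])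
  have ns: "nrm (dual_space V) (scl (dual_space V) c \<phi>) = norm c * nrm (dual_space V) \<phi>"
    if \<phi>: "\<phi> \<in> car (dual_space V)" for c \<phi>
  proof (cases "c = 0")
    case True
    have "nrm (dual_space V) (scl (dual_space V) c \<phi>) = 0"
      using scl[OF \<phi>, of c] dual_nrm_nonneg[of "scl (dual_space V) c \<phi>"] True by auto
    with True show ?thesis by simp
  next
    case False
    \<comment> \<open>The inequality \<open>scl\<close>, applied to \<open>inverse c\<close> and the
      multiple of \<phi> by \<open>c\<close>, yields the reverse inequality.\<close>
    have "nrm (dual_space V) \<phi> = nrm (dual_space V) (scl (dual_space V) (inverse c) (scl (dual_space V) c \<phi>))"
      using False by (subst D.scale_scale) simp
    also have "\<dots> \<le> norm (inverse c) * nrm (dual_space V) (scl (dual_space V) c \<phi>)"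
      using scl[OF \<phi>, of c] scl by blast
    finally have "norm c * nrm (dual_space V) \<phi> \<le> nrm (dual_space V) (scl (dual_space V) c \<phi>)"
      using False
      by (simp add: norm_inverse pos_le_divide_eq divide_inverse_commute[symmetric] mult.commute
          del: dual_space_sel)
    with scl[OF \<phi>, of c] show ?thesis by simp
  qed
  have eq0: "nrm (dual_space V) \<phi> = 0 \<longleftrightarrow> \<phi> = 0" if \<phi>: "\<phi> \<in> car (dual_space V)" for \<phi>
  proof
    assume "nrm (dual_space V) \<phi> = 0"
    then show "\<phi> = 0" using dual_bound[OF \<phi>] by (intro dual_space_eqI[OF \<phi> zero]) simp
  next
    assume "\<phi> = 0"
    then show "nrm (dual_space V) \<phi> = 0"
      using ns[OF zero, of 0] by (simp add: zero_fun_def)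
  qed
  show ?thesis
    unfolding normed_space_def
    using add scl zero ns eq0 dual_nrm_nonneg
    by (auto intro!: vector_space_dual_scl D.subspaceI simp del: dual_space_sel)
qed

text \<open>The limit of a Cauchy sequence of functionals is taken pointwise. The sort
  \<open>real_normed_field\<close> carries no completeness axiom, so completeness of the scalars is
  a hypothesis, supplied later by \<open>complete_scalars\<close>.\<close>

lemma Banach_dual_space:
  assumes k: "complete (UNIV :: 'k set)"
  shows "Banach_space (dual_space V)"
proof -
  interpret D: normed_vs "dual_space V" by unfold_locales (rule normed_dual_space)
  show ?thesis
    unfolding D.Banach_space_iff
  proof (intro allI impI; elim conjE)
    fix \<sigma> :: "nat \<Rightarrow> 'v \<Rightarrow> 'k" assume \<sigma>: "range \<sigma> \<subseteq> car (dual_space V)"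
      and ca: "\<forall>\<epsilon>>0. \<exists>N. \<forall>m\<ge>N. \<forall>n\<ge>N. nrm (dual_space V) (\<sigma> m - \<sigma> n) < \<epsilon>"
    have s: "\<sigma> n \<in> car (dual_space V)" for n using \<sigma> by blast
    have sb: "norm (\<sigma> m v - \<sigma> n v) \<le> nrm (dual_space V) (\<sigma> m - \<sigma> n) * nrm V v" if "v \<in> car V" for m n v
      using dual_bound[of "\<sigma> m - \<sigma> n" v] s that by simp
    have "Cauchy (\<lambda>n. \<sigma> n v)" if v: "v \<in> car V" for v
    proof (rule metric_CauchyI)
      fix \<epsilon> :: real assume "\<epsilon> > 0"
      have pos: "nrm V v + 1 > 0" using v by (simp add: add_nonneg_pos)
      with \<open>\<epsilon> > 0\<close> obtain N where N: "\<And>m n. m \<ge> N \<Longrightarrow> n \<ge> N \<Longrightarrow>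
          nrm (dual_space V) (\<sigma> m - \<sigma> n) < \<epsilon> / (nrm V v + 1)"
        using ca by (meson divide_pos_pos)
      have "dist (\<sigma> m v) (\<sigma> n v) < \<epsilon>" if "m \<ge> N" "n \<ge> N" for m n
      proof -
        have "norm (\<sigma> m v - \<sigma> n v) \<le> \<epsilon> / (nrm V v + 1) * nrm V v"
          using sb[OF v, of m n] N[OF that] v
          by (meson less_imp_le mult_right_mono nrm_nonneg order_trans)
        also have "\<dots> < \<epsilon>" using pos \<open>\<epsilon> > 0\<close> by (simp add: field_simps)
        finally show ?thesis by (simp add: dist_norm)
      qed
      then show "\<exists>M. \<forall>m\<ge>M. \<forall>n\<ge>M. dist (\<sigma> m v) (\<sigma> n v) < \<epsilon>" by blast
    qed
    then have "\<exists>l. (\<lambda>n. \<sigma> n v) \<longlonglongrightarrow> l" if "v \<in> car V" for v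
      using k that by (auto simp: complete_def)
    moreover have "\<sigma> n v = 0" if "v \<notin> car V" for n v using s that by (simp add: mem_dual_space)
    ultimately have "\<exists>l. (\<lambda>n. \<sigma> n v) \<longlonglongrightarrow> l" for v
      by (cases "v \<in> car V") auto
    then obtain \<phi> where \<phi>: "\<And>v. (\<lambda>n. \<sigma> n v) \<longlonglongrightarrow> \<phi> v" by metis
    \<comment> \<open>Letting \<open>m\<close> tend to infinity in the Cauchy estimate bounds the
      difference of \<sigma> n and \<phi> uniformly on the unit ball. With tolerance 1 this makes
      \<phi> bounded, with \<epsilon>/2 it gives convergence in norm.\<close>
    have near: "norm (\<sigma> n v - \<phi> v) \<le> \<epsilon> * nrm V v"
      if N: "\<And>m n. m \<ge> N \<Longrightarrow> n \<ge> N \<Longrightarrow> nrm (dual_space V) (\<sigma> m - \<sigma> n) < \<epsilon>"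
        and n: "n \<ge> N" and v: "v \<in> car V" for \<epsilon> N n v
    proof (rule tendsto_upperbound)
      show "(\<lambda>m. norm (\<sigma> n v - \<sigma> m v)) \<longlonglongrightarrow> norm (\<sigma> n v - \<phi> v)"
        by (intro tendsto_intros \<phi>)
      have "norm (\<sigma> n v - \<sigma> m v) \<le> \<epsilon> * nrm V v" if "m \<ge> N" for m
        using sb[OF v, of n m] N[OF n that] v
        by (meson less_imp_le mult_right_mono nrm_nonneg order_trans)
      then show "\<forall>\<^sub>F m in sequentially. norm (\<sigma> n v - \<sigma> m v) \<le> \<epsilon> * nrm V v"
        using eventually_sequentially by blast
    qed simp
    have "\<phi> (u + v) = \<phi> u + \<phi> v" if "u \<in> car V" "v \<in> car V" for u v
    proof -
      have "\<sigma> n (u + v) = \<sigma> n u + \<sigma> n v" for n using s[of n] that by (simp add: mem_dual_space)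
      then have "(\<lambda>n. \<sigma> n (u + v)) \<longlonglongrightarrow> \<phi> u + \<phi> v" using tendsto_add[OF \<phi> \<phi>] by simp
      then show ?thesis using \<phi> LIMSEQ_unique by blast
    qed
    moreover have "\<phi> (scl V c v) = c * \<phi> v" if "v \<in> car V" for c v
    proof -
      have "\<sigma> n (scl V c v) = c * \<sigma> n v" for n using s[of n] that by (simp add: mem_dual_space)
      then have "(\<lambda>n. \<sigma> n (scl V c v)) \<longlonglongrightarrow> c * \<phi> v" using tendsto_mult_left[OF \<phi>] by simp
      then show ?thesis using \<phi> LIMSEQ_unique by blast
    qed
    moreover have "\<phi> v = 0" if "v \<notin> car V" for v
      using \<phi>[of v] s that by (simp add: mem_dual_space LIMSEQ_const_iff)
    moreover have "\<exists>B. \<forall>v\<in>car V. norm (\<phi> v) \<le> B * nrm V v"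
    proof -
      obtain N where N: "\<And>m n. m \<ge> N \<Longrightarrow> n \<ge> N \<Longrightarrow> nrm (dual_space V) (\<sigma> m - \<sigma> n) < 1"
        using ca zero_less_one by meson
      have "norm (\<phi> v) \<le> (nrm (dual_space V) (\<sigma> N) + 1) * nrm V v" if "v \<in> car V" for v
        using near[of N 1 N v, OF N order_refl that] dual_bound[OF s[of N] that]
          norm_triangle_ineq2[of "\<phi> v" "\<sigma> N v"] by (simp add: algebra_simps norm_minus_commute)
      then show ?thesis by blast
    qed
    ultimately have mem: "\<phi> \<in> car (dual_space V)"
      unfolding mem_dual_space by blast
    have "\<exists>N. \<forall>n\<ge>N. nrm (dual_space V) (\<sigma> n - \<phi>) < \<epsilon>" if "\<epsilon> > 0" for \<epsilon>
    proof -
      have h: "\<epsilon> / 2 > 0" using that by simp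
      then obtain N where N: "\<And>m n. m \<ge> N \<Longrightarrow> n \<ge> N \<Longrightarrow> nrm (dual_space V) (\<sigma> m - \<sigma> n) < \<epsilon> / 2"
        using ca by meson
      have "nrm (dual_space V) (\<sigma> n - \<phi>) \<le> \<epsilon> / 2" if "n \<ge> N" for n
        using near[OF N that] h by (intro dual_nrm_le) auto
      then show ?thesis using h that by force
    qed
    with mem show "\<exists>l\<in>car (dual_space V). \<forall>\<epsilon>>0. \<exists>N. \<forall>n\<ge>N. nrm (dual_space V) (\<sigma> n - l) < \<epsilon>"
      by blast
  qed
qed

end

text \<open>For \<open>car E = {0}\<close> no completeness of the scalars can be read off from
  \<open>E\<close>; the spaces concerned are then trivial and are covered by this case.\<close>

lemma (in normed_vs) Banach_space_trivial:
  assumes "car V = {0}"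
  shows "Banach_space V"
  unfolding Banach_space_iff assms by (auto simp: image_subset_iff intro!: exI[of _ 0])

section \<open>Weak-star topologies and dual Banach algebras\<close>

context
  fixes D :: "('k::real_normed_field, 'v, 'm) nspace_scheme"
    and P :: "('k, 'p, 'n) nspace_scheme" and \<iota> :: "'v \<Rightarrow> 'p \<Rightarrow> 'k"
begin

lemma openin_weak_star_basis:
  assumes "p \<in> car P" "open U"
  shows "openin (weak_star_topology D P \<iota>) {d \<in> car D. \<iota> d p \<in> U}"
  unfolding weak_star_topology_def by (rule topology_generated_by_Basis) (use assms in blast)

lemma topspace_weak_star:
  assumes "car P \<noteq> {}"
  shows "topspace (weak_star_topology D P \<iota>) = car D"
proof -
  obtain p where "p \<in> car P" using assms by blast
  then have "\<exists>p' U. car D = {d \<in> car D. \<iota> d p' \<in> U} \<and> p' \<in> car P \<and> open U"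
    by (intro exI[of _ p] exI[of _ UNIV]) auto
  then show ?thesis
    unfolding weak_star_topology_def topology_generated_by_topspace by blast
qed

text \<open>Around each of its points, a generated open set is governed by finitely many subbasic
  conditions. Only exact agreement on \<open>Q\<close> is recorded, not closeness: for
  \<open>d0 = 0\<close> this describes a common kernel, which is stable under scaling.\<close>

lemma weak_star_neighbourhood:
  assumes "openin (weak_star_topology D P \<iota>) W" "d0 \<in> W"
  shows "\<exists>Q. finite Q \<and> Q \<subseteq> car P \<and> (\<forall>d\<in>car D. (\<forall>p\<in>Q. \<iota> d p = \<iota> d0 p) \<longrightarrow> d \<in> W)"
proof -
  have "generate_topology_on {{d \<in> car D. \<iota> d p \<in> U} | p U. p \<in> car P \<and> open U} W"
    using assms(1) by (simp add: weak_star_topology_def openin_topology_generated_by_iff)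
  then show ?thesis using assms(2)
  proof induction
    case (Int a b)
    then obtain Q R where "finite Q" "Q \<subseteq> car P" "\<forall>d\<in>car D. (\<forall>p\<in>Q. \<iota> d p = \<iota> d0 p) \<longrightarrow> d \<in> a"
      "finite R" "R \<subseteq> car P" "\<forall>d\<in>car D. (\<forall>p\<in>R. \<iota> d p = \<iota> d0 p) \<longrightarrow> d \<in> b" by auto
    then show ?case by (intro exI[of _ "Q \<union> R"]) auto
  next
    case (UN K)
    then obtain k where "k \<in> K" "d0 \<in> k" by blast
    with UN.IH obtain Q where "finite Q" "Q \<subseteq> car P" "\<forall>d\<in>car D. (\<forall>p\<in>Q. \<iota> d p = \<iota> d0 p) \<longrightarrow> d \<in> k"
      by meson
    with \<open>k \<in> K\<close> show ?case by (intro exI[of _ Q]) auto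
  next
    case (Basis s)
    then obtain p U where "s = {d \<in> car D. \<iota> d p \<in> U}" "p \<in> car P" by blast
    with Basis show ?case by (intro exI[of _ "{p}"]) auto
  qed simp
qed

text \<open>Continuity is checked on the subbasis: the condition at \<open>p\<close> pulls back
  along \<open>h\<close> to the same condition at \<open>q\<close>, so a preadjoint of
  \<open>h\<close> on \<open>P\<close> suffices.\<close>

lemma continuous_map_weak_star:
  assumes "car P \<noteq> {}" "h ` car D \<subseteq> car D"
    and adj: "\<And>p. p \<in> car P \<Longrightarrow> \<exists>q\<in>car P. \<forall>d\<in>car D. \<iota> (h d) p = \<iota> d q"
  shows "continuous_map (weak_star_topology D P \<iota>) (weak_star_topology D P \<iota>) h"
proof -
  have "openin (weak_star_topology D P \<iota>)
      (h -` {d \<in> car D. \<iota> d p \<in> U} \<inter> topspace (weak_star_topology D P \<iota>))"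
    if p: "p \<in> car P" and U: "open U" for p U
  proof -
    obtain q where "q \<in> car P" "\<forall>d\<in>car D. \<iota> (h d) p = \<iota> d q" using adj[OF p] by blast
    moreover from this have "h -` {d \<in> car D. \<iota> d p \<in> U} \<inter> topspace (weak_star_topology D P \<iota>)
        = {d \<in> car D. \<iota> d q \<in> U}"
      using assms by (auto simp: topspace_weak_star)
    ultimately show ?thesis using openin_weak_star_basis U by simp
  qed
  moreover have "h ` topspace (weak_star_topology D P \<iota>) \<subseteq> topspace (weak_star_topology D P \<iota>)"
    using assms by (simp add: topspace_weak_star)
  ultimately show ?thesis
    unfolding weak_star_topology_def[of D P \<iota>]
    by (intro continuous_on_generated_topo)
      (auto simp: weak_star_topology_def topology_generated_by_topspace)
qed

end

locale dual_Banach_alg =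
  fixes E :: "('k::real_normed_field, 'e::ab_group_add) nalgebra"
    and F :: "('k, 'f::ab_group_add) nspace"
    and \<iota> :: "'e \<Rightarrow> 'f \<Rightarrow> 'k"
  assumes dual_Banach_algebra: "dual_Banach_algebra E F \<iota>"
begin

sublocale E: normed_vs E
  using dual_Banach_algebra
  by unfold_locales (simp add: dual_Banach_algebra_def Banach_algebra_def Banach_space_def)

sublocale F: normed_vs F
  using dual_Banach_algebra by unfold_locales (simp add: dual_Banach_algebra_def Banach_space_def)

section \<open>The pairing of \<open>E\<close> with its predual \<open>F\<close>\<close>

lemma iota_iso: "isometric_iso E (dual_space F) \<iota>"
  using dual_Banach_algebra by (simp add: dual_Banach_algebra_def)

lemma iota_mem: "e \<in> car E \<Longrightarrow> \<iota> e \<in> car (dual_space F)"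
  using iota_iso by (auto simp: isometric_iso_def bij_betw_def)

lemma iota_surj: "\<phi> \<in> car (dual_space F) \<Longrightarrow> \<exists>e\<in>car E. \<iota> e = \<phi>"
  using iota_iso by (force simp: isometric_iso_def bij_betw_def)

lemma iota_add: "d \<in> car E \<Longrightarrow> e \<in> car E \<Longrightarrow> \<iota> (d + e) z = \<iota> d z + \<iota> e z"
  using iota_iso by (simp add: isometric_iso_def)

lemma iota_scl: "e \<in> car E \<Longrightarrow> \<iota> (scl E c e) z = c * \<iota> e z"
  using iota_iso by (simp add: isometric_iso_def)

lemma iota_diff: "d \<in> car E \<Longrightarrow> e \<in> car E \<Longrightarrow> \<iota> (d - e) z = \<iota> d z - \<iota> e z"
  using iota_add[of "d - e" e] by simp

lemma iota_zero: "\<iota> 0 z = 0"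
  using iota_diff[of 0 0] by simp

lemma iota_add_right: "e \<in> car E \<Longrightarrow> y \<in> car F \<Longrightarrow> z \<in> car F \<Longrightarrow> \<iota> e (y + z) = \<iota> e y + \<iota> e z"
  using iota_mem[of e] by (simp add: mem_dual_space)

lemma iota_scl_right: "e \<in> car E \<Longrightarrow> z \<in> car F \<Longrightarrow> \<iota> e (scl F c z) = c * \<iota> e z"
  using iota_mem[of e] by (simp add: mem_dual_space)

lemma nrm_iota: "e \<in> car E \<Longrightarrow> nrm (dual_space F) (\<iota> e) = nrm E e"
  using iota_iso by (simp add: isometric_iso_def)

lemma iota_bound: "e \<in> car E \<Longrightarrow> z \<in> car F \<Longrightarrow> norm (\<iota> e z) \<le> nrm E e * nrm F z"
  using F.dual_bound[OF iota_mem] by (simp add: nrm_iota)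

lemma nrm_le_if_iota_le:
  assumes "e \<in> car E" "0 \<le> B" "\<And>z. z \<in> car F \<Longrightarrow> norm (\<iota> e z) \<le> B * nrm F z"
  shows "nrm E e \<le> B"
  using F.dual_nrm_le[of B "\<iota> e"] assms by (simp add: nrm_iota)

text \<open>A functional vanishing on a finite intersection of kernels is a combination of the
  functionals that cut it out. The induction on \<open>Q\<close> keeps \<open>W\<close> general: the
  hypothesis is applied to the kernel of \<open>q\<close> in \<open>W\<close>, and the
  \<open>w\<close> found there is corrected by a multiple of \<open>q\<close>.\<close>

lemma finite_kernel_imp_iota:
  assumes "finite Q" "Q \<subseteq> car F" "E.subspace W" "W \<subseteq> car E"
    and "\<And>d e. d \<in> W \<Longrightarrow> e \<in> W \<Longrightarrow> \<phi> (d + e) = \<phi> d + \<phi> e"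
    and "\<And>c e. e \<in> W \<Longrightarrow> \<phi> (scl E c e) = c * \<phi> e"
    and "\<And>e. e \<in> W \<Longrightarrow> \<forall>q\<in>Q. \<iota> e q = 0 \<Longrightarrow> \<phi> e = 0"
  shows "\<exists>w\<in>car F. \<forall>e\<in>W. \<phi> e = \<iota> e w"
  using assms
proof (induction arbitrary: W)
  case empty
  have "\<iota> e 0 = 0" if "e \<in> W" for e
    using F.dual_zero[OF iota_mem] empty.prems that by blast
  with empty.prems show ?case by (intro bexI[of _ 0]) auto
next
  case (insert q Q)
  have q: "q \<in> car F" using insert.prems by simp
  have W: "e \<in> car E" if "e \<in> W" for e using insert.prems that by blast
  note sub = \<open>E.subspace W\<close>
  let ?W = "{e \<in> W. \<iota> e q = 0}"
  have "E.subspace ?W"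
    using W by (intro E.subspaceI)
      (auto simp: iota_zero iota_add iota_scl E.subspace_0[OF sub] E.subspace_add[OF sub]
        E.subspace_scale[OF sub])
  then have "\<exists>w\<in>car F. \<forall>e\<in>?W. \<phi> e = \<iota> e w"
    using insert.prems by (intro insert.IH) auto
  then obtain w where w: "w \<in> car F" "\<And>e. e \<in> W \<Longrightarrow> \<iota> e q = 0 \<Longrightarrow> \<phi> e = \<iota> e w"
    by blast
  show ?case
  proof (cases "\<forall>e\<in>W. \<iota> e q = 0")
    case True
    with w show ?thesis by blast
  next
    case False
    then obtain e0 where e0: "e0 \<in> W" "\<iota> e0 q \<noteq> 0" by blast
    \<comment> \<open>Chosen so that the corrected functional agrees with \<phi> at
      \<open>e0\<close>. Every \<open>e\<close> in \<open>W\<close> differs from a multiple of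
      \<open>e0\<close> by an element of the kernel of \<open>q\<close>, where \<open>w\<close>
      already represents \<phi>.\<close>
    let ?s = "(\<phi> e0 - \<iota> e0 w) / \<iota> e0 q"
    have "\<phi> e = \<iota> e (w + scl F ?s q)" if e: "e \<in> W" for e
    proof -
      let ?t = "\<iota> e q / \<iota> e0 q"
      let ?e = "e - scl E ?t e0"
      have t: "scl E ?t e0 \<in> W" using e0 sub E.subspace_scale by blast
      then have e': "?e \<in> W" using e sub E.subspace_diff by blast
      moreover have "\<iota> ?e q = 0" using e e0 W t by (simp add: iota_diff iota_scl)
      ultimately have "\<phi> ?e = \<iota> ?e w" by (rule w)
      moreover have "\<phi> e = \<phi> ?e + ?t * \<phi> e0"
        using insert.prems(4)[OF e' t] insert.prems(5)[OF e0(1), of ?t] by simp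
      moreover have "\<iota> ?e w = \<iota> e w - ?t * \<iota> e0 w"
        using e e0 W t by (simp add: iota_diff iota_scl)
      ultimately have "\<phi> e = \<iota> e w - ?t * \<iota> e0 w + ?t * \<phi> e0" by simp
      then have "\<phi> e = \<iota> e w + ?s * \<iota> e q"
        by (simp add: algebra_simps diff_divide_distrib)
      then show ?thesis using e W w q by (simp add: iota_add_right iota_scl_right)
    qed
    with w q show ?thesis by (intro bexI[of _ "w + scl F ?s q"]) auto
  qed
qed

text \<open>A weak-star continuous functional is bounded by \<open>1\<close> on the common kernel of finitely many
  elements of the predual, hence vanishes there and is a linear combination of them.\<close>

lemma weak_star_continuous_imp_adjoint:
  assumes h: "continuous_map (weak_star_topology E F \<iota>) (weak_star_topology E F \<iota>) h"
    and hE: "\<And>e. e \<in> car E \<Longrightarrow> h e \<in> car E"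
    and add: "\<And>d e. d \<in> car E \<Longrightarrow> e \<in> car E \<Longrightarrow> h (d + e) = h d + h e"
    and scl: "\<And>c e. e \<in> car E \<Longrightarrow> h (scl E c e) = scl E c (h e)"
    and z: "z \<in> car F"
  shows "\<exists>w\<in>car F. \<forall>e\<in>car E. \<iota> (h e) z = \<iota> e w"
proof -
  have ts: "topspace (weak_star_topology E F \<iota>) = car E"
    using F.zero_mem by (intro topspace_weak_star) blast
  have h0: "h 0 = 0" using add[of 0 0] by simp
  let ?U = "{e \<in> car E. \<iota> e z \<in> ball 0 1}"
  have "openin (weak_star_topology E F \<iota>) {e \<in> car E. h e \<in> ?U}"
    using openin_continuous_map_preimage[OF h openin_weak_star_basis[OF z open_ball[of 0 1]]] ts by simp
  moreover have "0 \<in> {e \<in> car E. h e \<in> ?U}" by (simp add: h0 iota_zero)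
  ultimately have "\<exists>Q. finite Q \<and> Q \<subseteq> car F \<and>
      (\<forall>d\<in>car E. (\<forall>p\<in>Q. \<iota> d p = \<iota> 0 p) \<longrightarrow> d \<in> {e \<in> car E. h e \<in> ?U})"
    by (rule weak_star_neighbourhood)
  then obtain Q where Q: "finite Q" "Q \<subseteq> car F"
    and "\<forall>d\<in>car E. (\<forall>p\<in>Q. \<iota> d p = \<iota> 0 p) \<longrightarrow> d \<in> {e \<in> car E. h e \<in> ?U}"
    by (elim exE conjE) (rule that)
  then have Q1: "norm (\<iota> (h e) z) < 1" if "e \<in> car E" "\<forall>p\<in>Q. \<iota> e p = 0" for e
    using that by (simp add: iota_zero)
  show ?thesis
  proof (rule finite_kernel_imp_iota[OF Q E.subspace_car order_refl])
    show "\<iota> (h e) z = 0" if e: "e \<in> car E" "\<forall>q\<in>Q. \<iota> e q = 0" for e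
    proof (rule ccontr)
      assume nz: "\<iota> (h e) z \<noteq> 0"
      \<comment> \<open>Rescaling stays inside the common kernel but moves the value at
        \<open>z\<close> to 1, against \<open>Q1\<close>.\<close>
      let ?e = "scl E (inverse (\<iota> (h e) z)) e"
      have "norm (\<iota> (h ?e) z) < 1" using e by (intro Q1) (auto simp: iota_scl)
      moreover have "\<iota> (h ?e) z = 1" using e nz by (simp add: scl hE iota_scl)
      ultimately show False by simp
    qed
  qed (simp_all add: add scl hE iota_add iota_scl)
qed

section \<open>Multiplication in \<open>E\<close>, its adjoint, and completeness of the
  scalars\<close>

lemma mul_mem: "a \<in> car E \<Longrightarrow> b \<in> car E \<Longrightarrow> mul E a b \<in> car E"
  and mul_assoc: "a \<in> car E \<Longrightarrow> b \<in> car E \<Longrightarrow> c \<in> car E \<Longrightarrow> mul E (mul E a b) c = mul E a (mul E b c)"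
  and mul_add_left: "a \<in> car E \<Longrightarrow> b \<in> car E \<Longrightarrow> c \<in> car E \<Longrightarrow> mul E (a + b) c = mul E a c + mul E b c"
  and mul_add_right: "a \<in> car E \<Longrightarrow> b \<in> car E \<Longrightarrow> c \<in> car E \<Longrightarrow> mul E a (b + c) = mul E a b + mul E a c"
  and mul_scl_left: "a \<in> car E \<Longrightarrow> b \<in> car E \<Longrightarrow> mul E (scl E k a) b = scl E k (mul E a b)"
  and mul_scl_right: "a \<in> car E \<Longrightarrow> b \<in> car E \<Longrightarrow> mul E a (scl E k b) = scl E k (mul E a b)"
  using dual_Banach_algebra unfolding dual_Banach_algebra_def Banach_algebra_def by blast+

lemma mul_diff_left:
  "a \<in> car E \<Longrightarrow> b \<in> car E \<Longrightarrow> c \<in> car E \<Longrightarrow> mul E (a - b) c = mul E a c - mul E b c"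
  using mul_add_left[of "a - b" b c] by simp

lemma mul_diff_right:
  "a \<in> car E \<Longrightarrow> b \<in> car E \<Longrightarrow> c \<in> car E \<Longrightarrow> mul E a (b - c) = mul E a b - mul E a c"
  using mul_add_right[of a "b - c" c] by simp

text \<open>The constant in \<open>Banach_algebra\<close> carries no sign; its absolute value is
  taken so that later products of bounds are monotone.\<close>

lemma mul_bound:
  obtains C where "0 \<le> C"
    "\<forall>a\<in>car E. \<forall>b\<in>car E. nrm E (mul E a b) \<le> C * nrm E a * nrm E b"
proof -
  obtain C where C: "\<forall>a\<in>car E. \<forall>b\<in>car E. nrm E (mul E a b) \<le> C * nrm E a * nrm E b"
    using dual_Banach_algebra unfolding dual_Banach_algebra_def Banach_algebra_def by blast
  have "nrm E (mul E a b) \<le> \<bar>C\<bar> * nrm E a * nrm E b" if "a \<in> car E" "b \<in> car E" for a b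
  proof -
    have "C * nrm E a * nrm E b \<le> \<bar>C\<bar> * nrm E a * nrm E b"
      using that by (intro mult_right_mono) auto
    with C that show ?thesis by force
  qed
  then show thesis using that[of "\<bar>C\<bar>"] by simp
qed

text \<open>Together with its mirror image this says that \<open>F\<close>, viewed inside the dual
  of \<open>E\<close>, is invariant under the module actions of \<open>E\<close>. Both come from the
  separate weak-star continuity of the product.\<close>

lemma adjoint_mul_left:
  assumes "a \<in> car E" "z \<in> car F"
  shows "\<exists>w\<in>car F. \<forall>e\<in>car E. \<iota> (mul E a e) z = \<iota> e w"
  using dual_Banach_algebra assms
  by (intro weak_star_continuous_imp_adjoint)
    (simp_all add: dual_Banach_algebra_def mul_mem mul_add_right mul_scl_right)

lemma adjoint_mul_right:
  assumes "a \<in> car E" "z \<in> car F"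
  shows "\<exists>w\<in>car F. \<forall>e\<in>car E. \<iota> (mul E e a) z = \<iota> e w"
  using dual_Banach_algebra assms
  by (intro weak_star_continuous_imp_adjoint)
    (simp_all add: dual_Banach_algebra_def mul_mem mul_add_left mul_scl_left)

text \<open>If \<open>E\<close> has a nonzero element, then it contains a copy of the scalars that is detected by a
  functional from \<open>F\<close>, so the scalars inherit completeness without the Gelfand--Mazur theorem.\<close>

lemma complete_scalars:
  assumes "car E \<noteq> {0}"
  shows "complete (UNIV :: 'k set)"
proof -
  obtain e where e: "e \<in> car E" "e \<noteq> 0" using assms E.zero_mem by blast
  have pos: "nrm E e > 0" using e by (metis E.nrm_eq_0_iff E.nrm_nonneg order_le_less)
  \<comment> \<open>As \<iota> is isometric, an \<open>e\<close> annihilated by all of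
    \<open>F\<close> would have norm 0.\<close>
  obtain z where z: "z \<in> car F" "\<iota> e z \<noteq> 0"
    using nrm_le_if_iota_le[OF e(1), of 0] pos by force
  have "\<exists>l. c \<longlonglongrightarrow> l" if c: "Cauchy c" for c :: "nat \<Rightarrow> 'k"
  proof -
    have eq: "nrm E (scl E (c m) e - scl E (c n) e) = norm (c m - c n) * nrm E e" for m n
      using E.nrm_scl[OF e(1), of "c m - c n"] by (simp add: E.scale_left_diff_distrib)
    have "\<exists>N. \<forall>m\<ge>N. \<forall>n\<ge>N. nrm E (scl E (c m) e - scl E (c n) e) < \<epsilon>" if "\<epsilon> > 0" for \<epsilon>
    proof -
      have "\<epsilon> / nrm E e > 0" using that pos by simp
      then obtain N where "\<forall>m\<ge>N. \<forall>n\<ge>N. norm (c m - c n) < \<epsilon> / nrm E e"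
        using c unfolding Cauchy_def dist_norm by blast
      then show ?thesis using pos by (auto simp: eq pos_less_divide_eq)
    qed
    moreover have "range (\<lambda>n. scl E (c n) e) \<subseteq> car E" using e by auto
    moreover have "Banach_space E"
      using dual_Banach_algebra by (simp add: dual_Banach_algebra_def Banach_algebra_def)
    ultimately obtain l where l: "l \<in> car E"
      "\<forall>\<epsilon>>0. \<exists>N. \<forall>n\<ge>N. nrm E (scl E (c n) e - l) < \<epsilon>"
      using E.Banach_space_limit[of "\<lambda>n. scl E (c n) e"] by blast
    \<comment> \<open>Pairing with \<open>z\<close> turns convergence in \<open>E\<close> into
      convergence of scalars; dividing by the nonzero \<open>\<iota> e z\<close> then gives a limit
      of \<open>c\<close>.\<close>
    have "(\<lambda>n. nrm E (scl E (c n) e - l) * nrm F z) \<longlonglongrightarrow> 0 * nrm F z"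
      using l e by (intro tendsto_mult_right LIMSEQ_I) simp
    then have lim0: "(\<lambda>n. nrm E (scl E (c n) e - l) * nrm F z) \<longlonglongrightarrow> 0" by simp
    have "(\<lambda>n. c n * \<iota> e z - \<iota> l z) \<longlonglongrightarrow> 0"
    proof (rule Lim_null_comparison[OF always_eventually lim0], rule allI)
      show "norm (c n * \<iota> e z - \<iota> l z) \<le> nrm E (scl E (c n) e - l) * nrm F z" for n
        using iota_bound[of "scl E (c n) e - l" z] e l z by (simp add: iota_diff iota_scl)
    qed
    then have "(\<lambda>n. c n * \<iota> e z) \<longlonglongrightarrow> \<iota> l z" by (simp add: LIM_zero_iff)
    then have "(\<lambda>n. c n * \<iota> e z / \<iota> e z) \<longlonglongrightarrow> \<iota> l z / \<iota> e z"
      using z by (intro tendsto_divide tendsto_const)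
    then show ?thesis using z by auto
  qed
  then show ?thesis by (simp add: complete_def)
qed

end

section \<open>Lipschitz algebras\<close>

context dual_Banach_alg
begin

text \<open>One constant \<open>B\<close> serves for both suprema, and the multiplied-out form
  includes \<open>x = y\<close>, where both sides are 0. Later membership proofs thereby avoid
  quotients.\<close>

lemma mem_Lip:
  fixes f :: "'x::metric_space \<Rightarrow> 'e"
  shows "f \<in> car (Lip E) \<longleftrightarrow> range f \<subseteq> car E \<and>
    (\<exists>B. (\<forall>x. nrm E (f x) \<le> B) \<and> (\<forall>x y. nrm E (f x - f y) \<le> B * dist x y))"
proof (intro iffI conjI; (elim conjE)?)
  assume f: "f \<in> car (Lip E)"
  then show r: "range f \<subseteq> car E" by (simp add: Lip_def)
  obtain A B where A: "\<And>x. nrm E (f x) \<le> A" and B: "\<And>q. q \<in> lip_quotients E f \<Longrightarrow> q \<le> B"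
    using f unfolding Lip_def bdd_above_def by auto (metis rangeI)
  have "nrm E (f x - f y) \<le> max A B * dist x y" for x y
  proof (cases "x = y")
    case False
    then have "nrm E (f x - f y) / dist x y \<le> B" by (intro B) (auto simp: lip_quotients_def)
    also have "B \<le> max A B" by simp
    finally show ?thesis using False by (simp add: pos_divide_le_eq)
  qed simp
  moreover have "nrm E (f x) \<le> max A B" for x using A[of x] by simp
  ultimately show "\<exists>B. (\<forall>x. nrm E (f x) \<le> B) \<and> (\<forall>x y. nrm E (f x - f y) \<le> B * dist x y)"
    by blast
next
  assume r: "range f \<subseteq> car E"
    and "\<exists>B. (\<forall>x. nrm E (f x) \<le> B) \<and> (\<forall>x y. nrm E (f x - f y) \<le> B * dist x y)"
  then obtain B where B: "\<And>x. nrm E (f x) \<le> B" "\<And>x y. nrm E (f x - f y) \<le> B * dist x y"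
    by blast
  have "q \<le> B" if "q \<in> lip_quotients E f" for q
    using that B(2) by (auto simp: lip_quotients_def pos_divide_le_eq)
  then have "bdd_above (lip_quotients E f)" by (rule bdd_aboveI)
  moreover have "bdd_above (range (\<lambda>x. nrm E (f x)))" using B(1) by (rule bdd_aboveI2)
  ultimately show "f \<in> car (Lip E)" using r by (simp add: Lip_def)
qed

lemma nrm_Lip: "nrm (Lip E) f = max (lip_const E f) (SUP x. nrm E (f x))"
  by (simp add: Lip_def)

lemma scl_Lip: "scl (Lip E) c f = (\<lambda>x. scl E c (f x))"
  by (simp add: Lip_def)

lemma scl_Lip_apply: "scl (Lip E) c f x = scl E c (f x)"
  by (simp add: scl_Lip)

lemma mul_Lip: "mul (Lip E) f g = (\<lambda>x. mul E (f x) (g x))"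
  by (simp add: Lip_def)

lemma Lip_apply_mem: "f \<in> car (Lip E) \<Longrightarrow> f x \<in> car E"
  by (auto simp: Lip_def)

lemma nrm_apply_le:
  assumes "f \<in> car (Lip E)"
  shows "nrm E (f x) \<le> nrm (Lip E) f"
proof -
  have "nrm E (f x) \<le> (SUP x. nrm E (f x))"
    using assms by (intro cSUP_upper) (auto simp: Lip_def)
  then show ?thesis by (simp add: nrm_Lip)
qed

lemma nrm_diff_apply_le:
  assumes "f \<in> car (Lip E)"
  shows "nrm E (f x - f y) \<le> nrm (Lip E) f * dist x y"
proof (cases "x = y")
  case False
  then have "nrm E (f x - f y) / dist x y \<le> lip_const E f"
    unfolding lip_const_def using assms
    by (intro cSup_upper) (auto simp: Lip_def lip_quotients_def)
  also have "\<dots> \<le> nrm (Lip E) f" by (simp add: nrm_Lip)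
  finally show ?thesis using False by (simp add: pos_divide_le_eq)
qed simp

lemma nrm_Lip_le:
  assumes "f \<in> car (Lip E)" "\<And>x. nrm E (f x) \<le> B" "\<And>x y. nrm E (f x - f y) \<le> B * dist x y"
  shows "nrm (Lip E) f \<le> B"
proof -
  \<comment> \<open>The 0 inserted in \<open>lip_const\<close> requires \<open>B\<close> to be
    nonnegative; the bound at any point of the nonempty point type provides this.\<close>
  have "0 \<le> B" using assms(2) E.nrm_nonneg[OF Lip_apply_mem[OF assms(1)]] order_trans by blast
  then have "lip_const E f \<le> B"
    unfolding lip_const_def using assms(3)
    by (intro cSup_least) (auto simp: lip_quotients_def pos_divide_le_eq)
  moreover have "(SUP x. nrm E (f x)) \<le> B" using assms(2) by (intro cSUP_least) auto
  ultimately show ?thesis by (simp add: nrm_Lip)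
qed

lemma nrm_Lip_nonneg: "f \<in> car (Lip E) \<Longrightarrow> 0 \<le> nrm (Lip E) f"
  using nrm_apply_le[of f undefined] E.nrm_nonneg[OF Lip_apply_mem] order_trans by blast

section \<open>The algebra structure of \<open>Lip E\<close>\<close>

lemma Lip_add:
  assumes "f \<in> car (Lip E)" "g \<in> car (Lip E)"
  shows "f + g \<in> car (Lip E) \<and> nrm (Lip E) (f + g) \<le> nrm (Lip E) f + nrm (Lip E) g"
proof -
  note m = Lip_apply_mem[OF assms(1)] Lip_apply_mem[OF assms(2)]
  have 1: "nrm E ((f + g) x) \<le> nrm (Lip E) f + nrm (Lip E) g" for x
    using E.nrm_triangle[OF m] nrm_apply_le[OF assms(1), of x] nrm_apply_le[OF assms(2), of x]
    by (fastforce intro: order_trans)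
  have 2: "nrm E ((f + g) x - (f + g) y) \<le> (nrm (Lip E) f + nrm (Lip E) g) * dist x y" for x y
    using E.nrm_triangle[of "f x - f y" "g x - g y"] m
      nrm_diff_apply_le[OF assms(1), of x y] nrm_diff_apply_le[OF assms(2), of x y]
    by (simp add: algebra_simps)
  have "f + g \<in> car (Lip E)" unfolding mem_Lip using 1 2 m by auto
  with 1 2 show ?thesis by (intro conjI nrm_Lip_le)
qed

lemma Lip_scl:
  assumes "f \<in> car (Lip E)"
  shows "scl (Lip E) c f \<in> car (Lip E) \<and> nrm (Lip E) (scl (Lip E) c f) \<le> norm c * nrm (Lip E) f"
proof -
  note m = Lip_apply_mem[OF assms]
  have 1: "nrm E (scl (Lip E) c f x) \<le> norm c * nrm (Lip E) f" for x
    using nrm_apply_le[OF assms, of x] m by (simp add: scl_Lip E.nrm_scl mult_left_mono)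
  have 2: "nrm E (scl (Lip E) c f x - scl (Lip E) c f y) \<le> norm c * nrm (Lip E) f * dist x y" for x y
    using mult_left_mono[OF nrm_diff_apply_le[OF assms, of x y], of "norm c"] m
      E.nrm_scl[of "f x - f y" c]
    by (simp add: scl_Lip E.scale_right_diff_distrib mult.assoc)
  have "scl (Lip E) c f \<in> car (Lip E)" unfolding mem_Lip using 1 2 m by (auto simp: scl_Lip)
  with 1 2 show ?thesis by (intro conjI nrm_Lip_le)
qed

lemma vector_space_scl_Lip: "vector_space (scl (Lip E))"
  by unfold_locales
    (auto simp: scl_Lip fun_eq_iff E.scale_right_distrib E.scale_left_distrib)

lemma normed_space_Lip: "normed_space (Lip E :: ('k, 'x::metric_space \<Rightarrow> 'e) nalgebra)"
proof -
  let ?L = "Lip E :: ('k, 'x \<Rightarrow> 'e) nalgebra"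
  interpret V: vector_space "scl ?L" by (rule vector_space_scl_Lip)
  have zero: "0 \<in> car ?L" unfolding mem_Lip by (auto intro!: exI[of _ 0])
  have eq0: "nrm ?L f = 0 \<longleftrightarrow> f = 0" if f: "f \<in> car ?L" for f
  proof
    assume 0: "nrm ?L f = 0"
    show "f = 0"
    proof
      fix x
      have "nrm E (f x) = 0"
        using nrm_apply_le[OF f, of x] 0 E.nrm_nonneg[OF Lip_apply_mem[OF f]]
        by (simp add: order_antisym)
      then show "f x = 0 x" using E.nrm_eq_0_iff[OF Lip_apply_mem[OF f]] by simp
    qed
  next
    assume "f = 0"
    then show "nrm ?L f = 0"
      using nrm_Lip_le[OF zero, of 0] nrm_Lip_nonneg[OF zero] by simp
  qed
  have ns: "nrm ?L (scl ?L c f) = norm c * nrm ?L f" if f: "f \<in> car ?L" for c f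
  proof (cases "c = 0")
    case True
    then show ?thesis using eq0[OF zero] by simp
  next
    case False
    have "nrm ?L f = nrm ?L (scl ?L (inverse c) (scl ?L c f))"
      using False by (subst V.scale_scale) simp
    also have "\<dots> \<le> norm (inverse c) * nrm ?L (scl ?L c f)"
      using Lip_scl[OF f, of c] Lip_scl by blast
    finally have "norm c * nrm ?L f \<le> nrm ?L (scl ?L c f)"
      using False
      by (simp add: norm_inverse pos_le_divide_eq divide_inverse_commute[symmetric] mult.commute)
    with Lip_scl[OF f, of c] show ?thesis by simp
  qed
  show ?thesis
    unfolding normed_space_def
    using Lip_add Lip_scl zero ns eq0 nrm_Lip_nonneg
    by (auto intro!: vector_space_scl_Lip V.subspaceI)
qed

text \<open>The factor 2 comes from the Lipschitz part of the norm: the difference of two products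
  splits as in the product rule into two terms, each bounded by \<open>C\<close> times both norms
  times the distance.\<close>

lemma Lip_mul:
  assumes C: "0 \<le> C"
    "\<forall>a\<in>car E. \<forall>b\<in>car E. nrm E (mul E a b) \<le> C * nrm E a * nrm E b"
    and f: "f \<in> car (Lip E)" and g: "g \<in> car (Lip E)"
  shows "mul (Lip E) f g \<in> car (Lip E) \<and>
    nrm (Lip E) (mul (Lip E) f g) \<le> 2 * C * nrm (Lip E) f * nrm (Lip E) g"
proof -
  let ?p = "mul (Lip E) f g" and ?B = "C * nrm (Lip E) f * nrm (Lip E) g"
  note m = Lip_apply_mem[OF f] Lip_apply_mem[OF g]
  note nn = nrm_Lip_nonneg[OF f] nrm_Lip_nonneg[OF g]
  have B: "0 \<le> ?B" using C nn by simp
  have prod: "nrm E (mul E a b) \<le> C * r * s"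
    if "a \<in> car E" "b \<in> car E" "nrm E a \<le> r" "nrm E b \<le> s" for a b r s
  proof -
    have "0 \<le> r" using E.nrm_nonneg[OF that(1)] that(3) by linarith
    then have "C * nrm E a * nrm E b \<le> C * r * s"
      using that C by (intro mult_mono mult_nonneg_nonneg) auto
    with C(2) that show ?thesis by fastforce
  qed
  have 1: "nrm E (?p x) \<le> 2 * C * nrm (Lip E) f * nrm (Lip E) g" for x
    using prod[OF m nrm_apply_le[OF f] nrm_apply_le[OF g], of x x] B
    by (simp add: mul_Lip)
  have 2: "nrm E (?p x - ?p y) \<le> 2 * C * nrm (Lip E) f * nrm (Lip E) g * dist x y" for x y
  proof -
    have "?p x - ?p y = mul E (f x - f y) (g x) + mul E (f y) (g x - g y)"
      using m by (simp add: mul_Lip mul_diff_left mul_diff_right)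
    also have "nrm E \<dots> \<le> nrm E (mul E (f x - f y) (g x)) + nrm E (mul E (f y) (g x - g y))"
      using m by (intro E.nrm_triangle mul_mem E.diff_mem)
    also have "nrm E (mul E (f x - f y) (g x)) \<le> C * (nrm (Lip E) f * dist x y) * nrm (Lip E) g"
      using m f g by (intro prod nrm_diff_apply_le nrm_apply_le E.diff_mem)
    also have "nrm E (mul E (f y) (g x - g y)) \<le> C * nrm (Lip E) f * (nrm (Lip E) g * dist x y)"
      using m f g by (intro prod nrm_diff_apply_le nrm_apply_le E.diff_mem)
    finally show ?thesis by (simp add: algebra_simps)
  qed
  have "?p \<in> car (Lip E)" unfolding mem_Lip using 1 2 m by (auto simp: mul_Lip mul_mem)
  with 1 2 show ?thesis by (intro conjI nrm_Lip_le)
qed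

text \<open>Completeness enters as a hypothesis because it is derived only later, from the
  identification of \<open>Lip E\<close> with a dual space.\<close>

lemma Banach_algebra_Lip:
  assumes "Banach_space (Lip E :: ('k, 'x::metric_space \<Rightarrow> 'e) nalgebra)"
  shows "Banach_algebra (Lip E :: ('k, 'x \<Rightarrow> 'e) nalgebra)"
proof -
  obtain C where C: "0 \<le> C"
    "\<forall>a\<in>car E. \<forall>b\<in>car E. nrm E (mul E a b) \<le> C * nrm E a * nrm E b"
    using mul_bound by blast
  note mul = Lip_mul[OF C]
  have "\<exists>C. \<forall>f\<in>car (Lip E). \<forall>g\<in>car (Lip E :: ('k, 'x \<Rightarrow> 'e) nalgebra).
      nrm (Lip E) (mul (Lip E) f g) \<le> C * nrm (Lip E) f * nrm (Lip E) g"
    using mul by blast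
  moreover have "mul (Lip E) f g \<in> car (Lip E)"
    if "f \<in> car (Lip E)" "g \<in> car (Lip E)" for f g :: "'x \<Rightarrow> 'e"
    using mul that by blast
  ultimately show ?thesis
    unfolding Banach_algebra_def using assms
    by (auto simp: mul_Lip scl_Lip fun_eq_iff Lip_apply_mem mul_assoc mul_add_left mul_add_right
        mul_scl_left mul_scl_right)
qed

end

section \<open>The predual of a Lipschitz algebra\<close>

text \<open>The parameter \<open>X\<close> only fixes the type of points, which does not occur in \<open>E\<close>, \<open>F\<close>, \<open>\<iota>\<close>.\<close>

locale dual_Lipschitz_algebra = dual_Banach_alg E F \<iota>
  for E :: "('k::real_normed_field, 'e::ab_group_add) nalgebra"
    and F :: "('k, 'f::ab_group_add) nspace" and \<iota> :: "'e \<Rightarrow> 'f \<Rightarrow> 'k" +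
  fixes X :: "'x::metric_space itself"
begin

abbreviation "L \<equiv> Lip E :: ('k, 'x \<Rightarrow> 'e) nalgebra"
abbreviation "T \<equiv> {point_tensor E \<iota> x z | (x::'x) z. z \<in> car F}"

sublocale L: normed_vs L by unfold_locales (rule normed_space_Lip)
sublocale D: normed_vs "dual_space L" by unfold_locales (rule L.normed_dual_space)

abbreviation "closed_span \<equiv> norm_topology (dual_space L) closure_of D.span T"

section \<open>Point tensors and their span\<close>

lemma point_tensor_apply: "f \<in> car L \<Longrightarrow> point_tensor E \<iota> x z f = \<iota> (f x) z"
  by (simp add: point_tensor_def)

lemma point_tensor_bound:
  assumes "z \<in> car F" "f \<in> car L"
  shows "norm (point_tensor E \<iota> x z f) \<le> nrm F z * nrm L f"
proof -
  have "norm (\<iota> (f x) z) \<le> nrm E (f x) * nrm F z"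
    using assms by (intro iota_bound Lip_apply_mem)
  also have "\<dots> \<le> nrm L f * nrm F z" using assms by (intro mult_right_mono nrm_apply_le) auto
  finally show ?thesis using assms by (simp add: point_tensor_apply mult.commute)
qed

lemma point_tensor_mem: "z \<in> car F \<Longrightarrow> point_tensor E \<iota> x z \<in> car (dual_space L)"
  using point_tensor_bound[of z _ x] unfolding mem_dual_space
  by (intro conjI ballI allI impI exI[of _ "nrm F z"])
    (simp_all add: point_tensor_apply scl_Lip_apply Lip_apply_mem iota_add iota_scl,
      simp add: point_tensor_def)

lemma nrm_point_tensor_le: "z \<in> car F \<Longrightarrow> nrm (dual_space L) (point_tensor E \<iota> x z) \<le> nrm F z"
  by (intro L.dual_nrm_le point_tensor_bound) auto

text \<open>Divided by \<open>dist x y\<close>, for distinct points, these differences are the test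
  functionals that detect the Lipschitz constant, as single point tensors detect the supremum
  norm.\<close>

lemma nrm_point_tensor_diff_le:
  assumes "z \<in> car F"
  shows "nrm (dual_space L) (point_tensor E \<iota> x z - point_tensor E \<iota> y z) \<le> dist x y * nrm F z"
proof (rule L.dual_nrm_le)
  show "0 \<le> dist x y * nrm F z" using assms by simp
  fix f assume f: "f \<in> car L"
  have "norm (\<iota> (f x - f y) z) \<le> nrm E (f x - f y) * nrm F z"
    using assms f by (intro iota_bound E.diff_mem Lip_apply_mem)
  also have "\<dots> \<le> nrm L f * dist x y * nrm F z"
    using assms f by (intro mult_right_mono nrm_diff_apply_le) auto
  finally show "norm ((point_tensor E \<iota> x z - point_tensor E \<iota> y z) f) \<le> dist x y * nrm F z * nrm L f"
    using f by (simp add: point_tensor_apply Lip_apply_mem iota_diff mult.commute mult.left_commute)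
qed

lemma point_tensor_add:
  "y \<in> car F \<Longrightarrow> z \<in> car F \<Longrightarrow>
   point_tensor E \<iota> x (y + z) = point_tensor E \<iota> (x::'x) y + point_tensor E \<iota> x z"
  by (auto simp: point_tensor_def fun_eq_iff iota_add_right Lip_apply_mem)

lemma point_tensor_scl:
  "z \<in> car F \<Longrightarrow> point_tensor E \<iota> (x::'x) (scl F c z) = scl (dual_space L) c (point_tensor E \<iota> x z)"
  by (auto simp: point_tensor_def fun_eq_iff iota_scl_right Lip_apply_mem)

lemma span_T_subset: "D.span T \<subseteq> car (dual_space L)"
  by (intro D.span_minimal D.subspace_car) (auto simp: point_tensor_mem)

lemma span_T_subset_closed_span: "D.span T \<subseteq> closed_span"
  using span_T_subset by (force simp: D.mem_norm_closure subset_iff)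

lemma subspace_closed_span: "D.subspace closed_span"
  by (intro D.subspace_norm_closure D.subspace_span span_T_subset)

end

text \<open>The duality is wanted twice: for the span itself, and for its closure, which is the
  predual. The arguments use only that \<open>S\<close> is a subspace lying between the two, so that
  both become instances.\<close>

locale tensor_span_between = dual_Lipschitz_algebra E F \<iota> X
  for E :: "('k::real_normed_field, 'e::ab_group_add) nalgebra"
    and F :: "('k, 'f::ab_group_add) nspace" and \<iota> :: "'e \<Rightarrow> 'f \<Rightarrow> 'k"
    and X :: "'x::metric_space itself" +
  fixes S :: "(('x \<Rightarrow> 'e) \<Rightarrow> 'k) set"
  assumes subspace_S: "D.subspace S"
    and span_subset_S: "D.span T \<subseteq> S" and S_subset_closed_span: "S \<subseteq> closed_span"
begin

abbreviation "P \<equiv> subspace_of (dual_space L) S"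

lemma S_subset: "S \<subseteq> car (dual_space L)"
  using S_subset_closed_span D.mem_norm_closure[OF span_T_subset] by blast

sublocale P: normed_vs P
  by unfold_locales (intro D.normed_subspace_of subspace_S S_subset)

sublocale P': normed_vs "dual_space P" by unfold_locales (rule P.normed_dual_space)

lemma point_tensor_mem_S: "z \<in> car F \<Longrightarrow> point_tensor E \<iota> x z \<in> S"
  using span_subset_S by (blast intro: D.span_base)

text \<open>By linearity the difference of the functionals vanishes on the span of the point
  tensors; by boundedness and density it then vanishes on all of \<open>S\<close>.\<close>

lemma dual_eqI_point_tensor:
  assumes \<phi>: "\<phi> \<in> car (dual_space P)" and \<psi>: "\<psi> \<in> car (dual_space P)"
    and eq: "\<And>x z. z \<in> car F \<Longrightarrow> \<phi> (point_tensor E \<iota> x z) = \<psi> (point_tensor E \<iota> x z)"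
  shows "\<phi> = \<psi>"
proof (rule dual_space_eqI[OF \<phi> \<psi>])
  define \<delta> where "\<delta> = \<phi> - \<psi>"
  have \<delta>: "\<delta> \<in> car (dual_space P)" using \<phi> \<psi> by (simp add: \<delta>_def)
  have add: "\<delta> (u + v) = \<delta> u + \<delta> v" if "u \<in> S" "v \<in> S" for u v
    using \<delta> that by (simp add: mem_dual_space)
  have scl: "\<delta> (scl (dual_space L) c u) = c * \<delta> u" if "u \<in> S" for c u
    using \<delta> that unfolding mem_dual_space by (simp del: dual_space_sel(1))
  have "D.subspace {u \<in> S. \<delta> u = 0}"
    using subspace_S add scl P.dual_zero[OF \<delta>]
    by (intro D.subspaceI)
      (auto simp: D.subspace_0 D.subspace_add D.subspace_scale simp del: dual_space_sel(1))
  moreover have "T \<subseteq> {u \<in> S. \<delta> u = 0}" using eq by (auto simp: \<delta>_def point_tensor_mem_S)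
  ultimately have "D.span T \<subseteq> {u \<in> S. \<delta> u = 0}" by (rule D.span_minimal[rotated])
  then have 0: "\<delta> v = 0" if "v \<in> D.span T" for v using that by blast
  fix u assume "u \<in> car P"
  then have u: "u \<in> S" by simp
  have "\<delta> u = 0"
  proof (rule ccontr)
    assume "\<delta> u \<noteq> 0"
    let ?N = "nrm (dual_space P) \<delta>"
    have N: "0 \<le> ?N" using \<delta> by (rule P.dual_nrm_nonneg)
    \<comment> \<open>An element of the span within this tolerance of \<open>u\<close> forces
      \<open>norm (\<delta> u)\<close> to be smaller than itself; the added 1 covers
      \<open>?N = 0\<close>.\<close>
    have "norm (\<delta> u) / (?N + 1) > 0" using N \<open>\<delta> u \<noteq> 0\<close> by simp
    then obtain v where v: "v \<in> D.span T" "nrm (dual_space L) (u - v) < norm (\<delta> u) / (?N + 1)"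
      using u S_subset_closed_span D.mem_norm_closure[OF span_T_subset] by blast
    have vS: "v \<in> S" using v span_subset_S by blast
    have "\<delta> u = \<delta> (u - v) + \<delta> v"
      using add[of "u - v" v] u vS D.subspace_diff[OF subspace_S] by simp
    then have "norm (\<delta> u) = norm (\<delta> (u - v))" using 0[OF v(1)] by simp
    also have "\<dots> \<le> ?N * nrm (dual_space L) (u - v)"
      using P.dual_bound[OF \<delta>, of "u - v"] u vS D.subspace_diff[OF subspace_S] by simp
    also have "\<dots> \<le> ?N * (norm (\<delta> u) / (?N + 1))" using v N by (intro mult_left_mono) auto
    also have "\<dots> < norm (\<delta> u)"
      using N \<open>\<delta> u \<noteq> 0\<close> by (simp add: divide_less_eq algebra_simps)
    finally show False by simp
  qed
  then show "\<phi> u = \<psi> u" by (simp add: \<delta>_def)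
qed

section \<open>Evaluation as an isometry onto the dual of \<open>P\<close>\<close>

lemma evaluation_apply: "u \<in> S \<Longrightarrow> evaluation P f u = u f"
  by (simp add: evaluation_def)

lemma evaluation_bound: "f \<in> car L \<Longrightarrow> u \<in> S \<Longrightarrow> norm (u f) \<le> nrm L f * nrm P u"
  using L.dual_bound[of u f] S_subset by (auto simp: mult.commute)

lemma evaluation_mem:
  assumes "f \<in> car L"
  shows "evaluation P f \<in> car (dual_space P)"
  unfolding mem_dual_space using evaluation_bound[OF assms] P.add_mem P.scl_mem
  by (auto simp: evaluation_def)

lemma nrm_evaluation:
  assumes f: "f \<in> car L"
  shows "nrm (dual_space P) (evaluation P f) = nrm L f"
proof (rule antisym)
  show "nrm (dual_space P) (evaluation P f) \<le> nrm L f"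
    using f evaluation_bound by (intro P.dual_nrm_le) (auto simp: evaluation_apply)
  let ?N = "nrm (dual_space P) (evaluation P f)"
  have N: "0 \<le> ?N" using evaluation_mem[OF f] by (rule P.dual_nrm_nonneg)
  \<comment> \<open>Applied to a point tensor this will bound the supremum norm of \<open>f\<close>,
    and applied to a difference of two it will bound the Lipschitz constant.\<close>
  have b: "norm (u f) \<le> ?N * B" if "u \<in> S" "nrm (dual_space L) u \<le> B" for u B
  proof -
    have "norm (u f) \<le> ?N * nrm (dual_space L) u"
      using P.dual_bound[OF evaluation_mem[OF f], of u] that by (simp add: evaluation_apply)
    also have "\<dots> \<le> ?N * B" using that N by (intro mult_left_mono)
    finally show ?thesis .
  qed
  show "nrm L f \<le> ?N"
  proof (rule nrm_Lip_le[OF f])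
    fix x y :: 'x
    show "nrm E (f x) \<le> ?N"
    proof (rule nrm_le_if_iota_le[OF Lip_apply_mem[OF f] N])
      fix z assume "z \<in> car F"
      then show "norm (\<iota> (f x) z) \<le> ?N * nrm F z"
        using b[OF point_tensor_mem_S[of z x] nrm_point_tensor_le[of z x]] f
        by (simp add: point_tensor_apply)
    qed
    show "nrm E (f x - f y) \<le> ?N * dist x y"
    proof (rule nrm_le_if_iota_le)
      fix z assume "z \<in> car F"
      then show "norm (\<iota> (f x - f y) z) \<le> ?N * dist x y * nrm F z"
        using b[OF D.subspace_diff[OF subspace_S point_tensor_mem_S[of z x] point_tensor_mem_S[of z y]]
            nrm_point_tensor_diff_le[of z x y]] f
        by (simp add: point_tensor_apply iota_diff Lip_apply_mem mult.assoc)
    qed (use N f in \<open>auto simp: Lip_apply_mem\<close>)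
  qed
qed

lemma evaluation_surj:
  assumes \<phi>: "\<phi> \<in> car (dual_space P)"
  shows "\<exists>f\<in>car L. evaluation P f = \<phi>"
proof -
  let ?N = "nrm (dual_space P) \<phi>"
  have N: "0 \<le> ?N" using \<phi> by (rule P.dual_nrm_nonneg)
  have b: "norm (\<phi> u) \<le> ?N * B" if "u \<in> S" "nrm (dual_space L) u \<le> B" for u B
  proof -
    have "norm (\<phi> u) \<le> ?N * nrm (dual_space L) u" using P.dual_bound[OF \<phi>, of u] that by simp
    also have "\<dots> \<le> ?N * B" using that N by (intro mult_left_mono)
    finally show ?thesis .
  qed
  have add: "\<phi> (u + v) = \<phi> u + \<phi> v" if "u \<in> S" "v \<in> S" for u v
    using \<phi> that by (simp add: mem_dual_space)
  have scl: "\<phi> (scl (dual_space L) c u) = c * \<phi> u" if "u \<in> S" for c u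
    using \<phi> that unfolding mem_dual_space by (simp del: dual_space_sel(1))
  have diff: "\<phi> (u - v) = \<phi> u - \<phi> v" if "u \<in> S" "v \<in> S" for u v
    using add[of "u - v" v] that D.subspace_diff[OF subspace_S] by simp
  have "\<exists>e\<in>car E. \<forall>z\<in>car F. \<iota> e z = \<phi> (point_tensor E \<iota> x z)" for x
  proof -
    \<comment> \<open>The value 0 off \<open>car F\<close> follows the convention for elements of
      \<open>dual_space F\<close>, so that \<open>iota_surj\<close> applies.\<close>
    let ?\<psi> = "\<lambda>z. if z \<in> car F then \<phi> (point_tensor E \<iota> x z) else 0"
    have "\<exists>B. \<forall>z\<in>car F. norm (?\<psi> z) \<le> B * nrm F z"
      using b[OF point_tensor_mem_S nrm_point_tensor_le] by (intro exI[of _ ?N]) simp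
    then have "?\<psi> \<in> car (dual_space F)"
      unfolding mem_dual_space
      by (simp add: point_tensor_add point_tensor_scl add scl point_tensor_mem_S
          del: dual_space_sel(1))
    then obtain e where "e \<in> car E" "\<iota> e = ?\<psi>" using iota_surj by blast
    then show ?thesis by (intro bexI[of _ e]) auto
  qed
  then obtain f where f: "\<And>x. f x \<in> car E"
    and ft: "\<And>x z. z \<in> car F \<Longrightarrow> \<iota> (f x) z = \<phi> (point_tensor E \<iota> x z)"
    by metis
  \<comment> \<open>The test functionals that gave the isometry, now with \<phi> in place of an
    evaluation, show that \<open>f\<close> is bounded and Lipschitz.\<close>
  have "nrm E (f x) \<le> ?N" for x
    by (rule nrm_le_if_iota_le[OF f N])
      (simp add: ft b[OF point_tensor_mem_S nrm_point_tensor_le])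
  moreover have "nrm E (f x - f y) \<le> ?N * dist x y" for x y
  proof (rule nrm_le_if_iota_le)
    fix z assume z: "z \<in> car F"
    have "\<phi> (point_tensor E \<iota> x z - point_tensor E \<iota> y z) = \<iota> (f x - f y) z"
      using z f by (simp add: diff point_tensor_mem_S ft iota_diff)
    then show "norm (\<iota> (f x - f y) z) \<le> ?N * dist x y * nrm F z"
      using b[OF D.subspace_diff[OF subspace_S point_tensor_mem_S[of z x] point_tensor_mem_S[of z y]]
            nrm_point_tensor_diff_le[of z x y]] z by (simp add: mult.assoc)
  qed (use N f in auto)
  ultimately have fL: "f \<in> car L" using f unfolding mem_Lip by blast
  have "evaluation P f = \<phi>"
    by (rule dual_eqI_point_tensor[OF evaluation_mem[OF fL] \<phi>])
      (simp add: evaluation_apply point_tensor_mem_S point_tensor_apply[OF fL] ft)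
  with fL show ?thesis by blast
qed

lemma isometric_iso_evaluation: "isometric_iso L (dual_space P) (evaluation P)"
proof -
  have add: "evaluation P (f + g) = evaluation P f + evaluation P g"
    if "f \<in> car L" "g \<in> car L" for f g
  proof
    fix u show "evaluation P (f + g) u = (evaluation P f + evaluation P g) u"
      using that S_subset by (auto simp: evaluation_def mem_dual_space subset_iff)
  qed
  have scl: "evaluation P (scl L c f) = scl (dual_space P) c (evaluation P f)"
    if "f \<in> car L" for c f
  proof
    fix u show "evaluation P (scl L c f) u = scl (dual_space P) c (evaluation P f) u"
      using that S_subset by (auto simp: evaluation_def mem_dual_space subset_iff)
  qed
  have "inj_on (evaluation P) (car L)"
  proof (rule inj_onI)
    fix f g assume fg: "f \<in> car L" "g \<in> car L" "evaluation P f = evaluation P g"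
    have "evaluation P f = evaluation P (f - g) + evaluation P g"
      using add[of "f - g" g] fg by simp
    then have "evaluation P (f - g) = 0" using fg by simp
    then have "nrm L (f - g) = 0" using nrm_evaluation[of "f - g"] fg by simp
    then show "f = g" using fg by simp
  qed
  moreover have "evaluation P ` car L = car (dual_space P)"
    using evaluation_mem evaluation_surj by blast
  ultimately show ?thesis
    unfolding isometric_iso_def using add scl nrm_evaluation by (simp add: bij_betw_def)
qed

text \<open>This is the sense in which the canonical map is determined by its values on point
  tensors; uniqueness comes from \<open>dual_eqI_point_tensor\<close>.\<close>

lemma eq_evaluation_iff:
  assumes "f \<in> car L" "\<phi> \<in> car (dual_space P)"
  shows "(\<forall>x. \<forall>z\<in>car F. \<phi> (point_tensor E \<iota> x z) = \<iota> (f x) z) \<longleftrightarrow> \<phi> = evaluation P f"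
  using dual_eqI_point_tensor[OF assms(2) evaluation_mem[OF assms(1)]]
  by (auto simp: evaluation_apply point_tensor_mem_S point_tensor_apply[OF assms(1)])

end

section \<open>The span and its closure as instances, and weak-star continuity of
  multiplication\<close>

context dual_Lipschitz_algebra
begin

sublocale S: tensor_span_between E F \<iota> X "D.span T"
  by unfold_locales (auto simp: D.subspace_span span_T_subset_closed_span[THEN subsetD])

sublocale C: tensor_span_between E F \<iota> X closed_span
  by unfold_locales (auto intro: subspace_closed_span span_T_subset_closed_span[THEN subsetD])

text \<open>\<open>complete_scalars\<close> applies only to nonzero \<open>E\<close>; for zero
  \<open>E\<close> both \<open>Lip E\<close> and its dual are trivial.\<close>

lemma Banach_space_dual_Lip: "Banach_space (dual_space L)"
proof (cases "car E = {0}")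
  case False
  then show ?thesis by (intro L.Banach_dual_space complete_scalars)
next
  case True
  have "f = 0" if "f \<in> car L" for f
    using Lip_apply_mem[OF that] True by (auto simp: fun_eq_iff)
  then have "\<phi> = 0" if "\<phi> \<in> car (dual_space L)" for \<phi>
    using L.dual_zero[OF that] that by (intro dual_space_eqI[of _ L]) auto
  then have "car (dual_space L) = {0}" using D.zero_mem by blast
  then show ?thesis by (rule D.Banach_space_trivial)
qed

text \<open>For nonzero \<open>E\<close> no limit of Lipschitz maps is constructed: completeness is
  transported from the dual of the span along evaluation.\<close>

lemma Banach_space_Lip: "Banach_space L"
proof (cases "car E = {0}")
  case False
  then show ?thesis
    by (intro L.Banach_space_isometric_iso[OF S.isometric_iso_evaluation] S.P.Banach_dual_space
        complete_scalars)
next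
  case True
  then have "car L = {0}"
    using Lip_apply_mem L.zero_mem by (force simp: fun_eq_iff)
  then show ?thesis by (rule L.Banach_space_trivial)
qed

text \<open>Left and right multiplication are treated together as a bounded linear map
  \<open>h\<close>. The hypothesis \<open>adj\<close> is pointwise: the adjoint of \<open>h\<close>
  takes a tensor at \<open>x\<close> to a tensor at the same \<open>x\<close>.\<close>

lemma Lip_continuous_map_weak_star:
  assumes h: "\<And>f. f \<in> car L \<Longrightarrow> h f \<in> car L"
    and add: "\<And>f g. f \<in> car L \<Longrightarrow> g \<in> car L \<Longrightarrow> h (f + g) = h f + h g"
    and scl: "\<And>c f. f \<in> car L \<Longrightarrow> h (scl L c f) = scl L c (h f)"
    and bound: "0 \<le> C" "\<And>f. f \<in> car L \<Longrightarrow> nrm L (h f) \<le> C * nrm L f"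
    and adj: "\<And>x z. z \<in> car F \<Longrightarrow> \<exists>w\<in>car F. \<forall>f\<in>car L. \<iota> (h f x) z = \<iota> (f x) w"
  shows "continuous_map (weak_star_topology L C.P (evaluation C.P))
     (weak_star_topology L C.P (evaluation C.P)) h"
proof -
  \<comment> \<open>The Banach space adjoint of \<open>h\<close>, cut off outside
    \<open>car L\<close> by the convention of \<open>dual_space\<close>. Its linearity laws hold for
    arbitrary functions, without side conditions.\<close>
  define h' where "h' u = (\<lambda>f. if f \<in> car L then u (h f) else 0)" for u :: "('x \<Rightarrow> 'e) \<Rightarrow> 'k"
  have h'_bound: "norm (h' u f) \<le> C * nrm (dual_space L) u * nrm L f"
    if "u \<in> car (dual_space L)" "f \<in> car L" for u f
  proof -
    have "norm (u (h f)) \<le> nrm (dual_space L) u * nrm L (h f)"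
      using that h by (intro L.dual_bound)
    also have "\<dots> \<le> nrm (dual_space L) u * (C * nrm L f)"
      using that bound by (intro mult_left_mono L.dual_nrm_nonneg)
    finally show ?thesis using that by (simp add: h'_def mult_ac)
  qed
  have h'_mem: "h' u \<in> car (dual_space L)" if u: "u \<in> car (dual_space L)" for u
  proof -
    have "\<exists>B. \<forall>f\<in>car L. norm (h' u f) \<le> B * nrm L f" using h'_bound[OF u] by blast
    then show ?thesis using u h by (auto simp: mem_dual_space h'_def add scl)
  qed
  have h'_diff: "h' (u - v) = h' u - h' v" and h'_add: "h' (u + v) = h' u + h' v"
    and h'_scl: "h' (scl (dual_space L) c u) = scl (dual_space L) c (h' u)" for u v c
    by (auto simp: h'_def fun_eq_iff)
  have h'_zero: "h' 0 = 0" by (auto simp: h'_def fun_eq_iff)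
  have "D.subspace {u. h' u \<in> D.span T}"
    by (intro D.subspaceI)
      (auto simp: h'_zero h'_add h'_scl D.span_zero D.span_add D.span_scale simp del: dual_space_sel(1))
  moreover have "T \<subseteq> {u. h' u \<in> D.span T}"
  proof clarify
    fix x z assume "z \<in> car F"
    from adj[OF this] obtain w where w: "w \<in> car F" "\<forall>f\<in>car L. \<iota> (h f x) z = \<iota> (f x) w" by blast
    then have "h' (point_tensor E \<iota> x z) = point_tensor E \<iota> x w"
      using h by (auto simp: h'_def point_tensor_def fun_eq_iff)
    with w show "h' (point_tensor E \<iota> x z) \<in> D.span T" by (auto intro: D.span_base)
  qed
  ultimately have span: "h' u \<in> D.span T" if "u \<in> D.span T" for u
    using D.span_minimal that by blast
  \<comment> \<open>Approximants of \<open>u\<close> in the span are mapped into the span, and the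
    distance to the image of \<open>u\<close> grows at most by the factor \<open>C\<close>.\<close>
  have closed: "h' u \<in> closed_span" if u: "u \<in> closed_span" for u
    unfolding D.mem_norm_closure[OF span_T_subset]
  proof (intro conjI allI impI)
    have uD: "u \<in> car (dual_space L)" using u C.S_subset by blast
    then show "h' u \<in> car (dual_space L)" by (rule h'_mem)
    fix \<epsilon> :: real assume "\<epsilon> > 0"
    then have "\<epsilon> / (C + 1) > 0" using bound by simp
    then obtain v where v: "v \<in> D.span T" "nrm (dual_space L) (u - v) < \<epsilon> / (C + 1)"
      using u D.mem_norm_closure[OF span_T_subset] by blast
    have "u - v \<in> car (dual_space L)" using uD v span_T_subset by (intro D.diff_mem) auto
    then have "nrm (dual_space L) (h' (u - v)) \<le> C * nrm (dual_space L) (u - v)"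
      using bound h'_bound by (intro L.dual_nrm_le mult_nonneg_nonneg L.dual_nrm_nonneg)
    also have "\<dots> \<le> C * (\<epsilon> / (C + 1))" using v bound by (intro mult_left_mono) auto
    also have "\<dots> < \<epsilon>" using bound \<open>\<epsilon> > 0\<close> by (simp add: divide_less_eq algebra_simps)
    finally have "nrm (dual_space L) (h' u - h' v) < \<epsilon>" by (simp add: h'_diff)
    with span[OF v(1)] show "\<exists>v\<in>D.span T. nrm (dual_space L) (h' u - v) < \<epsilon>" by blast
  qed
  show ?thesis
  proof (rule continuous_map_weak_star)
    show "car C.P \<noteq> {}" using C.P.zero_mem by blast
    show "h ` car L \<subseteq> car L" using h by blast
    fix u assume "u \<in> car C.P"
    then have u: "u \<in> closed_span" by simp
    \<comment> \<open>The witness is \<open>h' u\<close>: evaluating \<open>h f\<close> at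
      \<open>u\<close> is evaluating \<open>f\<close> at \<open>h' u\<close>.\<close>
    then show "\<exists>q\<in>car C.P. \<forall>f\<in>car L. evaluation C.P (h f) u = evaluation C.P f q"
      using closed[OF u]
      by (intro bexI[of _ "h' u"]) (simp_all add: C.evaluation_apply h'_def[of u])
  qed
qed

lemma dual_Banach_algebra_Lip: "dual_Banach_algebra L C.P (evaluation C.P)"
proof -
  obtain C where C: "0 \<le> C"
    "\<forall>a\<in>car E. \<forall>b\<in>car E. nrm E (mul E a b) \<le> C * nrm E a * nrm E b"
    using mul_bound by blast
  note mul = Lip_mul[OF C]
  have "continuous_map (weak_star_topology L C.P (evaluation C.P))
      (weak_star_topology L C.P (evaluation C.P)) (mul L a)"
    if a: "a \<in> car L" for a
  proof (rule Lip_continuous_map_weak_star)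
    show "0 \<le> 2 * C * nrm L a" using C a by simp
    \<comment> \<open>The element \<open>w\<close> represents multiplication by the single value
      \<open>a x\<close> followed by pairing with \<open>z\<close>, so it may vary with
      \<open>x\<close>.\<close>
    show "\<exists>w\<in>car F. \<forall>f\<in>car L. \<iota> (mul L a f x) z = \<iota> (f x) w" if "z \<in> car F" for x z
      using adjoint_mul_left[OF Lip_apply_mem[OF a] that, of x] Lip_apply_mem
      unfolding mul_Lip by blast
  qed (use a mul[OF a] in \<open>auto simp: mul_Lip scl_Lip fun_eq_iff Lip_apply_mem mul_add_right mul_scl_right\<close>)
  moreover have "continuous_map (weak_star_topology L C.P (evaluation C.P))
      (weak_star_topology L C.P (evaluation C.P)) (\<lambda>d. mul L d a)"
    if a: "a \<in> car L" for a
  proof (rule Lip_continuous_map_weak_star)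
    show "0 \<le> 2 * C * nrm L a" using C a by simp
    show "\<exists>w\<in>car F. \<forall>f\<in>car L. \<iota> (mul L f a x) z = \<iota> (f x) w" if "z \<in> car F" for x z
      using adjoint_mul_right[OF Lip_apply_mem[OF a] that, of x] Lip_apply_mem
      unfolding mul_Lip by blast
    show "nrm L (mul L f a) \<le> 2 * C * nrm L a * nrm L f" if "f \<in> car L" for f
      using mul[OF that a] by (simp add: mult_ac)
  qed (use a mul in \<open>auto simp: mul_Lip scl_Lip fun_eq_iff Lip_apply_mem mul_add_left mul_scl_left\<close>)
  ultimately show ?thesis
    unfolding dual_Banach_algebra_def
    using C.isometric_iso_evaluation Banach_algebra_Lip[OF Banach_space_Lip]
      D.Banach_space_norm_closure[OF Banach_space_dual_Lip D.subspace_span span_T_subset]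
    by blast
qed

end

theorem proposition2p10:
  fixes E :: "('k::real_normed_field, 'e::ab_group_add) nalgebra"
    and F :: "('k, 'f::ab_group_add) nspace"
    and \<iota> :: "'e \<Rightarrow> 'f \<Rightarrow> 'k"
  assumes "dual_Banach_algebra E F \<iota>"
  shows "(\<forall>f \<in> car (Lip E :: ('k, 'x::metric_space \<Rightarrow> 'e) nalgebra).
           \<forall>\<phi> \<in> car (dual_space (tensor_span E F \<iota>)).
             (\<forall>x. \<forall>z \<in> car F. \<phi> (point_tensor E \<iota> x z) = \<iota> (f x) z) \<longleftrightarrow>
             \<phi> = evaluation (tensor_span E F \<iota>) f) \<and>
         isometric_iso (Lip E :: ('k, 'x \<Rightarrow> 'e) nalgebra) (dual_space (tensor_span E F \<iota>))
           (evaluation (tensor_span E F \<iota>)) \<and>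
         dual_Banach_algebra (Lip E :: ('k, 'x \<Rightarrow> 'e) nalgebra) (tensor_predual E F \<iota>)
           (evaluation (tensor_predual E F \<iota>))"
proof -
  interpret dual_Lipschitz_algebra E F \<iota> "TYPE('x)"
    by unfold_locales (rule assms)
  have span: "tensor_span E F \<iota> = S.P" by (simp add: tensor_span_def)
  then have predual: "tensor_predual E F \<iota> = C.P" by (simp add: tensor_predual_def)
  show ?thesis
    unfolding span predual
    using S.eq_evaluation_iff S.isometric_iso_evaluation dual_Banach_algebra_Lip by blast
qed

end
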